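(* Fix $r>0$. Consider a family of positive, almost surely finite base times $T_0$ with continuous distribution, with Laplace transforms $\hat f_0(\lambda)=E[e^{-\lambda T_0}]$; let $T$ be the completion time under Poisson resetting at rate $r$, and put \[ p=\hat f_0(r),\qquad \alpha=\frac{p+r\,\hat f_0'(r)}{1-p}. \] If along the family $p\to0$ and $|\alpha|/p\to\infty$, then \[ d_{\mathrm K}\!\left(\frac{T}{E[T]},\,\mathrm{Exp}(1)\right)\in\bigl[1-o(1),\,2+o(1)\bigr]\cdot|\alpha|, \] i.e. for every $\eta>0$ one has eventually along the family $(1-\eta)|\alpha|\le d_{\mathrm K}(T/E[T],\mathrm{Exp}(1))\le(2+\eta)|\alpha|$.
   Context: $\mathrm{Exp}(\lambda)$ is the exponential distribution with rate $\lambda$; $d_{\mathrm K}(X,Y)=\sup_x|P(X\le x)-P(Y\le x)|$ is the Kolmogorov distance. Poisson resetting at rate $r$: catastrophes occur according to a Poisson process of rate $r$ independent of the task; each catastrophe destroys all progress, and the task restarts with a fresh independent copy of $T_0$. Formally, attempts $i=1,2,\dots$ are independent; attempt $i$ has a copy $T_0^{(i)}$ of $T_0$ and an independent $\tau_i\sim\mathrm{Exp}(r)$; it succeeds iff $T_0^{(i)}<\tau_i$, and lasts time $\min(T_0^{(i)},\tau_i)$. $T$ is the total length of all attempts up to and including the first successful one. The success probability of an attempt is $p=\hat f_0(r)$, and $E[T]=(1-p)/(rp)$. *)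

theory Defs
  imports "HOL-Probability.Probability"
begin

definition kolmogorov_dist :: "real measure \<Rightarrow> real measure \<Rightarrow> real" where
  "kolmogorov_dist \<mu> \<nu> = (SUP x. \<bar>cdf \<mu> x - cdf \<nu> x\<bar>)"

definition exp_dist :: "real \<Rightarrow> real measure" where
  "exp_dist l = density lborel (exponential_density l)"

definition laplace_transform :: "'a measure \<Rightarrow> ('a \<Rightarrow> real) \<Rightarrow> real \<Rightarrow> real" where
  "laplace_transform M X l = (\<integral>\<omega>. exp (- l * X \<omega>) \<partial>M)"

text \<open>``Continuous distribution'' means that the distribution function is continuous
  (no atoms); a density is not required.\<close>

locale base_time = prob_space N for N :: "'a measure" +
  fixes T0 :: "'a \<Rightarrow> real"
  assumes measurable_T0: "random_variable borel T0"
    and positive_T0: "AE \<omega> in N. T0 \<omega> > 0"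
    and continuous_T0: "continuous_on UNIV (cdf (distr N borel T0))"

text \<open>\<open>X n\<close> is the fresh copy of the base time (with law \<open>\<mu>\<close>) used in attempt \<open>n\<close>, and
  \<open>\<tau> n\<close> is the waiting time for the next catastrophe, counted from the start of that attempt.\<close>

locale poisson_resetting = prob_space M for M :: "'a measure" +
  fixes X \<tau> :: "nat \<Rightarrow> 'a \<Rightarrow> real" and r :: real and \<mu> :: "real measure"
  assumes measurable_X: "\<And>n. random_variable borel (X n)"
    and distr_X: "\<And>n. distr M borel (X n) = \<mu>"
    and measurable_tau: "\<And>n. random_variable borel (\<tau> n)"
    and distr_tau: "\<And>n. distr M borel (\<tau> n) = exp_dist r"
    and indep_within: "\<And>n. indep_var borel (X n) borel (\<tau> n)"
    and indep_attempts: "indep_vars (\<lambda>_. borel \<Otimes>\<^sub>M borel) (\<lambda>n \<omega>. (X n \<omega>, \<tau> n \<omega>)) UNIV"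

text \<open>The value 0 is a dummy for the outcomes on which no attempt succeeds; these form a
  null set whenever the success probability is positive.\<close>

definition completion_time ::
  "(nat \<Rightarrow> 'a \<Rightarrow> real) \<Rightarrow> (nat \<Rightarrow> 'a \<Rightarrow> real) \<Rightarrow> 'a \<Rightarrow> real" where
  "completion_time X \<tau> \<omega> =
     (if \<exists>n. X n \<omega> < \<tau> n \<omega>
      then \<Sum>n\<le>(LEAST n. X n \<omega> < \<tau> n \<omega>). min (X n \<omega>) (\<tau> n \<omega>)
      else 0)"

end

theory Submission
  imports Defs
begin

text \<open>
  Split \<open>T = W + S\<close>, where \<open>W\<close> is the time of the last catastrophe, a geometric sum, and \<open>S\<close> is
  the length of the successful attempt, independent of \<open>W\<close>. The tail of \<open>W\<close> solves a defective
  renewal equation, and exponentials that are super- or subsolutions of it give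
  \<open>(1 - b / r) exp (- b s) \<le> P(W > s) \<le> exp (- a s)\<close> for \<open>s \<ge> 0\<close> whenever
  \<open>f(r - a) \<ge> a / r\<close> and \<open>f(r - b) \<le> b / r\<close>, where \<open>f\<close> is the Laplace transform of \<open>T0\<close>.
  With \<open>D = - r f'(r)\<close>, a second-order expansion of \<open>f\<close> at \<open>r\<close> allows \<open>a = r p\<close> and
  \<open>b = r p (1 + 3 D)\<close>. Since \<open>S\<close> has density \<open>exp (- r x) / p\<close> with respect to the law of \<open>T0\<close>,
  the tail of \<open>T\<close> lies within \<open>8 D / 5\<close> of the exponential one, and at the time
  \<open>\<epsilon> E[T]\<close> it exceeds it by nearly \<open>D\<close>. Finally \<open>D\<close> is asymptotically \<open>\<bar>\<alpha>\<bar>\<close> because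
  \<open>p = o(\<bar>\<alpha>\<bar>)\<close>.
\<close>

section \<open>Integrals with respect to the exponential distribution\<close>

lemma sets_exp_dist [measurable_cong, simp]: "sets (exp_dist l) = sets borel"
  by (simp add: exp_dist_def)

lemma space_exp_dist [simp]: "space (exp_dist l) = UNIV"
  by (simp add: exp_dist_def)

lemma prob_space_exp_dist: "0 < l \<Longrightarrow> prob_space (exp_dist l)"
  unfolding exp_dist_def by (rule prob_space_exponential_density)

lemma nn_integral_exp_dist:
  assumes [measurable]: "f \<in> borel_measurable borel"
  shows "(\<integral>\<^sup>+u. f u \<partial>exp_dist l) = (\<integral>\<^sup>+u. ennreal (exponential_density l u) * f u \<partial>lborel)"
  unfolding exp_dist_def by (rule nn_integral_density) auto

lemma AE_exp_dist_pos: "AE u in exp_dist l. 0 < u"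
proof -
  have "AE u in lborel. u \<noteq> (0::real)"
    by (rule AE_lborel_singleton)
  then show ?thesis
    unfolding exp_dist_def
    by (subst AE_density) (auto simp: exponential_density_def elim!: eventually_mono)
qed

text \<open>Tilting by \<open>exp (b * u)\<close> turns the rate \<open>l\<close> into
  \<open>l - b\<close>, which gives an explicit antiderivative. Half-open intervals let adjacent
  pieces be added without overlap.\<close>

lemma nn_integral_exp_dist_Ioc:
  assumes l: "0 < l" and b: "b < l" and v: "0 \<le> v" "v \<le> y"
  shows "(\<integral>\<^sup>+u. ennreal (exp (b * u)) * indicator {v<..y} u \<partial>exp_dist l) =
    ennreal (l / (l - b) * (exp (- (l - b) * v) - exp (- (l - b) * y)))"
proof -
  let ?F = "\<lambda>u. - (l / (l - b)) * exp (- (l - b) * u)"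
  let ?f = "\<lambda>u. l * exp (- (l - b) * u)"
  \<comment> \<open>The closed interval required by the fundamental theorem of calculus differs from
    \<open>{v<..y}\<close> only by the null set \<open>{v}\<close>.\<close>
  have "AE u in lborel. u \<noteq> v"
    by (rule AE_lborel_singleton)
  then have "AE u in lborel. ennreal (exponential_density l u) * (ennreal (exp (b * u)) * indicator {v<..y} u)
      = ennreal (?f u) * indicator {v..y} u"
    by eventually_elim (use v l in \<open>auto simp: exponential_density_def indicator_def ennreal_mult[symmetric]
        exp_add[symmetric] algebra_simps\<close>)
  then have "(\<integral>\<^sup>+u. ennreal (exp (b * u)) * indicator {v<..y} u \<partial>exp_dist l)
      = (\<integral>\<^sup>+u. ennreal (?f u) * indicator {v..y} u \<partial>lborel)"
    by (subst nn_integral_exp_dist) (auto intro!: nn_integral_cong_AE)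
  also have "\<dots> = ennreal (?F y - ?F v)"
  proof (rule nn_integral_FTC_Icc[where F = ?F])
    show "?f \<in> borel_measurable borel"
      by measurable
    show "v \<le> y" by fact
  next
    fix x
    show "DERIV ?F x :> ?f x"
      using b by (auto intro!: derivative_eq_intros simp del: minus_diff_eq)
    show "0 \<le> ?f x" using l by simp
  qed
  also have "?F y - ?F v = l / (l - b) * (exp (- (l - b) * v) - exp (- (l - b) * y))"
    by (simp only: algebra_simps)
  finally show ?thesis .
qed

lemma emeasure_exp_dist_Ioc:
  assumes "0 < l" "0 \<le> v" "v \<le> y"
  shows "emeasure (exp_dist l) {v<..y} = ennreal (exp (- l * v) - exp (- l * y))"
proof -
  have "emeasure (exp_dist l) {v<..y} = (\<integral>\<^sup>+u. ennreal (exp (0 * u)) * indicator {v<..y} u \<partial>exp_dist l)"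
    by simp
  also have "\<dots> = ennreal (exp (- l * v) - exp (- l * y))"
    using assms by (subst nn_integral_exp_dist_Ioc) auto
  finally show ?thesis .
qed

lemma emeasure_exp_dist_atMost:
  assumes "0 < l" "0 \<le> y"
  shows "emeasure (exp_dist l) {..y} = ennreal (1 - exp (- l * y))"
  using emeasure_erlang_density[of l 0 y] assms by (simp add: exp_dist_def erlang_CDF_0)

lemma emeasure_exp_dist_greaterThan:
  assumes l: "0 < l" and y: "0 \<le> y"
  shows "emeasure (exp_dist l) {y<..} = ennreal (exp (- l * y))"
proof -
  interpret prob_space "exp_dist l" by (rule prob_space_exp_dist) fact
  have "prob {..y} = 1 - exp (- l * y)"
    using emeasure_exp_dist_atMost[OF l y] l y by (simp add: measure_def)
  then have "prob {y<..} = exp (- l * y)"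
    using prob_compl[of "{..y}"] by (simp add: Compl_eq_Diff_UNIV[symmetric])
  then show ?thesis
    by (simp add: emeasure_eq_measure)
qed

text \<open>This is the mean length of an attempt with base time \<open>y\<close>, later averaged
  over \<open>y\<close> to obtain the mean of the completion time. The integral is split at
  \<open>u = y\<close>.\<close>

lemma nn_integral_exp_dist_min:
  assumes l: "0 < l" and y: "0 \<le> y"
  shows "(\<integral>\<^sup>+u. ennreal (min y u) \<partial>exp_dist l) = ennreal ((1 - exp (- l * y)) / l)"
proof -
  let ?F = "\<lambda>u. - (u + 1 / l) * exp (- l * u)"
  have "(\<integral>\<^sup>+u. ennreal (min y u) \<partial>exp_dist l) =
      (\<integral>\<^sup>+u. ennreal u * indicator {..y} u + ennreal y * indicator {y<..} u \<partial>exp_dist l)"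
    by (intro nn_integral_cong) (auto simp: indicator_def min_def)
  also have "\<dots> = (\<integral>\<^sup>+u. ennreal u * indicator {..y} u \<partial>exp_dist l) + ennreal y * ennreal (exp (- l * y))"
    using emeasure_exp_dist_greaterThan[OF l y]
    by (subst nn_integral_add) (auto simp: nn_integral_cmult_indicator)
  also have "(\<integral>\<^sup>+u. ennreal u * indicator {..y} u \<partial>exp_dist l) =
      (\<integral>\<^sup>+u. ennreal (l * u * exp (- l * u)) * indicator {0..y} u \<partial>lborel)"
    using l by (subst nn_integral_exp_dist)
      (auto intro!: nn_integral_cong simp: exponential_density_def indicator_def ennreal_mult[symmetric] algebra_simps)
  also have "\<dots> = ennreal (?F y - ?F 0)"
  proof (rule nn_integral_FTC_Icc[where F = ?F])
    fix x assume x: "x \<in> {0..y}"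
    show "DERIV ?F x :> l * x * exp (- l * x)"
      using l by (auto intro!: derivative_eq_intros simp: field_simps)
    show "0 \<le> l * x * exp (- l * x)" using l x by simp
  qed (use y in auto)
  also have "\<dots> + ennreal y * ennreal (exp (- l * y)) = ennreal ((?F y - ?F 0) + y * exp (- l * y))"
  proof -
    \<comment> \<open>The first summand must be shown nonnegative before the two
      \<open>ennreal\<close> terms can be merged into one.\<close>
    have "exp (- l * y) * (1 + l * y) \<le> exp (- l * y) * exp (l * y)"
      by (intro mult_left_mono exp_ge_add_one_self) auto
    then have "0 \<le> ?F y - ?F 0"
      using l by (auto simp: field_simps exp_minus)
    then show ?thesis
      using y by (simp add: ennreal_mult)
  qed
  also have "(?F y - ?F 0) + y * exp (- l * y) = (1 - exp (- l * y)) / l"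
    using l by (simp add: field_simps)
  finally show ?thesis .
qed

section \<open>Independence of an attempt from the past\<close>

locale positive_resetting = poisson_resetting +
  assumes r_pos: "0 < r"
    and positive: "AE x in \<mu>. 0 < x"
begin

declare measurable_X [measurable] measurable_tau [measurable]

lemma sets_mu [measurable_cong, simp]: "sets \<mu> = sets borel"
  unfolding distr_X[of 0, symmetric] by simp

lemma space_mu [simp]: "space \<mu> = UNIV"
  unfolding distr_X[of 0, symmetric] by simp

lemma prob_space_mu: "prob_space \<mu>"
  unfolding distr_X[of 0, symmetric] by (rule prob_space_distr) simp

sublocale base: prob_space \<mu>
  by (rule prob_space_mu)

sublocale catastrophe: prob_space "exp_dist r"
  by (rule prob_space_exp_dist[OF r_pos])

sublocale attempt: pair_prob_space \<mu> "exp_dist r" ..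

lemma distr_attempt:
  "distr M (borel \<Otimes>\<^sub>M borel) (\<lambda>\<omega>. (X n \<omega>, \<tau> n \<omega>)) = \<mu> \<Otimes>\<^sub>M exp_dist r"
  using indep_within[of n] unfolding indep_var_distribution_eq distr_X distr_tau by simp

definition failed :: "nat \<Rightarrow> 'a \<Rightarrow> bool" where
  "failed n \<omega> \<longleftrightarrow> (\<forall>k<n. \<tau> k \<omega> \<le> X k \<omega>)"

text \<open>Only on \<open>failed n\<close> is this the starting time of attempt \<open>n\<close>:
  there each earlier attempt lasted until its catastrophe.\<close>

definition clock :: "nat \<Rightarrow> 'a \<Rightarrow> real" where
  "clock n \<omega> = (\<Sum>k<n. \<tau> k \<omega>)"

lemma measurable_failed [measurable]: "Measurable.pred M (failed n)"
  unfolding failed_def[abs_def] by measurable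

lemma measurable_clock [measurable]: "clock n \<in> borel_measurable M"
  unfolding clock_def[abs_def] by measurable

text \<open>Integral against the defective law of the starting time of attempt \<open>n\<close>; the
  missing mass belongs to outcomes with an earlier success.\<close>

definition restart_integral :: "nat \<Rightarrow> (real \<Rightarrow> ennreal) \<Rightarrow> ennreal" where
  "restart_integral n \<phi> = (\<integral>\<^sup>+\<omega>. (if failed n \<omega> then \<phi> (clock n \<omega>) else 0) \<partial>M)"

text \<open>The past is a function of the attempts in \<open>{..<n}\<close>, an index set disjoint
  from \<open>{n}\<close>. The event \<open>failed n\<close> is encoded as a real 0 or 1 so that it
  forms a real random vector with \<open>clock n\<close>.\<close>

lemma indep_past_attempt:
  "indep_var (borel \<Otimes>\<^sub>M borel) (\<lambda>\<omega>. (of_bool (failed n \<omega>), clock n \<omega>))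
     (borel \<Otimes>\<^sub>M borel) (\<lambda>\<omega>. (X n \<omega>, \<tau> n \<omega>))"
proof -
  let ?Z = "\<lambda>n \<omega>. (X n \<omega>, \<tau> n \<omega>)"
  let ?P = "\<lambda>A. PiM A (\<lambda>_::nat. borel \<Otimes>\<^sub>M borel :: (real \<times> real) measure)"
  let ?f = "\<lambda>g :: nat \<Rightarrow> real \<times> real. (of_bool (\<forall>k<n. snd (g k) \<le> fst (g k)) :: real, \<Sum>k<n. snd (g k))"
  have ind: "indep_var (?P {..<n}) (\<lambda>\<omega>. restrict (\<lambda>i. ?Z i \<omega>) {..<n})
      (?P {n}) (\<lambda>\<omega>. restrict (\<lambda>i. ?Z i \<omega>) {n})"
    by (rule indep_var_restrict[OF indep_attempts]) auto
  have c: "(\<lambda>g. g k) \<in> measurable (?P {..<n}) (borel \<Otimes>\<^sub>M borel)" if "k < n" for k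
    by (rule measurable_component_singleton) (use that in auto)
  have f: "?f \<in> measurable (?P {..<n}) (borel \<Otimes>\<^sub>M borel)"
  proof (rule measurable_Pair)
    have "Measurable.pred (?P {..<n}) (\<lambda>g. snd (g k) \<le> fst (g k))" if "k < n" for k
    proof -
      note c[OF that, measurable]
      show ?thesis by measurable
    qed
    then have "Measurable.pred (?P {..<n}) (\<lambda>g. \<forall>k\<in>{..<n}. snd (g k) \<le> fst (g k))"
      by (intro pred_intros_finite) auto
    then have [measurable]: "Measurable.pred (?P {..<n}) (\<lambda>g. \<forall>k<n. snd (g k) \<le> fst (g k))"
      by (simp add: Ball_def)
    show "(\<lambda>g. of_bool (\<forall>k<n. snd (g k) \<le> fst (g k)) :: real) \<in> borel_measurable (?P {..<n})"
      unfolding of_bool_def by measurable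
    show "(\<lambda>g. \<Sum>k<n. snd (g k)) \<in> borel_measurable (?P {..<n})"
      by (intro borel_measurable_sum measurable_compose[OF c measurable_snd]) auto
  qed
  have g: "(\<lambda>g. g n) \<in> measurable (?P {n}) (borel \<Otimes>\<^sub>M borel)"
    by (rule measurable_component_singleton) auto
  have "indep_var (borel \<Otimes>\<^sub>M borel) (?f \<circ> (\<lambda>\<omega>. restrict (\<lambda>i. ?Z i \<omega>) {..<n}))
      (borel \<Otimes>\<^sub>M borel) ((\<lambda>g. g n) \<circ> (\<lambda>\<omega>. restrict (\<lambda>i. ?Z i \<omega>) {n}))"
    by (rule indep_var_compose[OF ind f g])
  then show ?thesis
    by (simp add: comp_def failed_def clock_def)
qed

text \<open>By independence the joint law of the past and of attempt \<open>n\<close> is a product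
  measure, so attempt \<open>n\<close> can be integrated out first.\<close>

lemma nn_integral_next_attempt:
  assumes [measurable]: "(\<lambda>(a, x, u). \<psi> a x u) \<in> borel_measurable (borel \<Otimes>\<^sub>M borel \<Otimes>\<^sub>M borel)"
  shows "(\<integral>\<^sup>+\<omega>. (if failed n \<omega> then \<psi> (clock n \<omega>) (X n \<omega>) (\<tau> n \<omega>) else 0) \<partial>M) =
    restart_integral n (\<lambda>a. \<integral>\<^sup>+x. \<integral>\<^sup>+u. \<psi> a x u \<partial>exp_dist r \<partial>\<mu>)"
proof -
  let ?V = "\<lambda>\<omega>. (of_bool (failed n \<omega>) :: real, clock n \<omega>)"
  let ?Z = "\<lambda>\<omega>. (X n \<omega>, \<tau> n \<omega>)"
  let ?S = "borel \<Otimes>\<^sub>M borel :: (real \<times> real) measure"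
  let ?g = "\<lambda>((b, a), (x, u)). if b = 1 then \<psi> a x u else 0"
  have "(\<lambda>z. \<psi> (snd (fst z)) (fst (snd z)) (snd (snd z))) =
      (\<lambda>(a, x, u). \<psi> a x u) \<circ> (\<lambda>z :: (real \<times> real) \<times> real \<times> real. (snd (fst z), snd z))"
    by (auto simp: split_beta')
  also have "\<dots> \<in> borel_measurable (?S \<Otimes>\<^sub>M (borel \<Otimes>\<^sub>M borel))"
    by (rule measurable_comp[OF _ assms]) measurable
  finally have [measurable]: "(\<lambda>z. \<psi> (snd (fst z)) (fst (snd z)) (snd (snd z)))
      \<in> borel_measurable (?S \<Otimes>\<^sub>M (borel \<Otimes>\<^sub>M borel))" .
  have g: "?g \<in> borel_measurable (?S \<Otimes>\<^sub>M (borel \<Otimes>\<^sub>M borel))"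
    unfolding split_beta' by measurable
  have dist: "distr M ?S ?V \<Otimes>\<^sub>M (\<mu> \<Otimes>\<^sub>M exp_dist r) = distr M (?S \<Otimes>\<^sub>M (borel \<Otimes>\<^sub>M borel)) (\<lambda>\<omega>. (?V \<omega>, ?Z \<omega>))"
    using indep_past_attempt[of n] unfolding indep_var_distribution_eq distr_attempt by simp
  have V: "?V \<in> measurable M ?S"
    using indep_past_attempt[of n] by (rule indep_var_rv1)
  have "(\<integral>\<^sup>+\<omega>. (if failed n \<omega> then \<psi> (clock n \<omega>) (X n \<omega>) (\<tau> n \<omega>) else 0) \<partial>M) =
      (\<integral>\<^sup>+z. ?g z \<partial>distr M (?S \<Otimes>\<^sub>M (borel \<Otimes>\<^sub>M borel)) (\<lambda>\<omega>. (?V \<omega>, ?Z \<omega>)))"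
    by (subst nn_integral_distr) (use g V in auto)
  also have "\<dots> = (\<integral>\<^sup>+v. \<integral>\<^sup>+z. ?g (v, z) \<partial>(\<mu> \<Otimes>\<^sub>M exp_dist r) \<partial>distr M ?S ?V)"
    unfolding dist[symmetric] by (rule attempt.nn_integral_fst[symmetric]) (use g in simp)
  also have "\<dots> = (\<integral>\<^sup>+\<omega>. \<integral>\<^sup>+z. ?g (?V \<omega>, z) \<partial>(\<mu> \<Otimes>\<^sub>M exp_dist r) \<partial>M)"
    by (rule nn_integral_distr[OF V]) (use g in simp)
  also have "\<dots> = restart_integral n (\<lambda>a. \<integral>\<^sup>+x. \<integral>\<^sup>+u. \<psi> a x u \<partial>exp_dist r \<partial>\<mu>)"
    unfolding restart_integral_def
    by (intro nn_integral_cong) (auto simp: catastrophe.nn_integral_fst[symmetric])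
  finally show ?thesis .
qed

section \<open>Defective renewal sums\<close>

abbreviation L :: "real \<Rightarrow> real" where
  "L \<equiv> laplace_transform \<mu> (\<lambda>x. x)"

section \<open>Elementary properties of the Laplace transform of the base time\<close>

lemma integrable_exp:
  assumes "0 \<le> l"
  shows "integrable \<mu> (\<lambda>x. exp (- l * x))"
  using positive assms
  by (intro base.integrable_const_bound[where B = 1]) (auto elim!: eventually_mono)

lemma nn_integral_exp:
  assumes "0 \<le> l"
  shows "(\<integral>\<^sup>+x. ennreal (exp (- l * x)) \<partial>\<mu>) = ennreal (L l)"
  unfolding laplace_transform_def using integrable_exp[OF assms] by (intro nn_integral_eq_integral) auto

lemma L_le_1: "0 \<le> l \<Longrightarrow> L l \<le> 1"
  unfolding laplace_transform_def using positive
  by (intro base.integral_le_const integrable_exp) (auto elim!: eventually_mono)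

lemma L_pos:
  assumes "0 \<le> l"
  shows "0 < L l"
proof -
  have "(\<integral>x. (0::real) \<partial>\<mu>) < (\<integral>x. exp (- l * x) \<partial>\<mu>)"
    using base.emeasure_space_1 by (intro base.integral_less_AE_space integrable_exp assms) auto
  then show ?thesis by (simp add: laplace_transform_def)
qed

lemma nn_integral_1_minus_exp:
  assumes "0 \<le> l" "0 \<le> c"
  shows "(\<integral>\<^sup>+x. ennreal (c * (1 - exp (- l * x))) \<partial>\<mu>) = ennreal (c * (1 - L l))"
proof -
  have "(\<integral>\<^sup>+x. ennreal (c * (1 - exp (- l * x))) \<partial>\<mu>) = ennreal (\<integral>x. c * (1 - exp (- l * x)) \<partial>\<mu>)"
    using integrable_exp[OF assms(1)] positive assms
    by (intro nn_integral_eq_integral) (auto elim!: eventually_mono)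
  also have "(\<integral>x. c * (1 - exp (- l * x)) \<partial>\<mu>) = c * (1 - L l)"
    using integrable_exp[OF assms(1)] base.prob_space
    unfolding laplace_transform_def by simp
  finally show ?thesis .
qed

text \<open>Transition operator of the starting times: a failed attempt of length \<open>u\<close>
  moves the clock from \<open>a\<close> to \<open>a + u\<close>. It is defective, with total mass
  \<open>1 - L r\<close>.\<close>

definition restart_step :: "(real \<Rightarrow> ennreal) \<Rightarrow> real \<Rightarrow> ennreal" where
  "restart_step \<phi> a = (\<integral>\<^sup>+x. \<integral>\<^sup>+u. indicator {..x} u * \<phi> (a + u) \<partial>exp_dist r \<partial>\<mu>)"

lemma measurable_restart_step [measurable]:
  assumes [measurable]: "\<phi> \<in> borel_measurable borel"
  shows "restart_step \<phi> \<in> borel_measurable borel"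
proof -
  have [measurable]: "(\<lambda>z. indicator {..snd (fst z)} (snd z) * \<phi> (fst (fst z) + snd z))
      \<in> borel_measurable ((borel \<Otimes>\<^sub>M \<mu>) \<Otimes>\<^sub>M exp_dist r)"
  proof -
    have "(\<lambda>z. indicator {..snd (fst z)} (snd z) * \<phi> (fst (fst z) + snd z)) =
        (\<lambda>z. if snd z \<le> snd (fst z) then \<phi> (fst (fst z) + snd z) else 0)"
      by (auto simp: indicator_def)
    then show ?thesis by simp
  qed
  show ?thesis
    unfolding restart_step_def[abs_def]
    by (intro base.borel_measurable_nn_integral catastrophe.borel_measurable_nn_integral)
      (simp add: split_beta')
qed

lemma restart_integral_0 [simp]: "restart_integral 0 \<phi> = \<phi> 0"
  by (simp add: restart_integral_def failed_def clock_def emeasure_space_1)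

lemma restart_integral_Suc:
  assumes [measurable]: "\<phi> \<in> borel_measurable borel"
  shows "restart_integral (Suc n) \<phi> = restart_integral n (restart_step \<phi>)"
proof -
  have "restart_integral (Suc n) \<phi> = (\<integral>\<^sup>+\<omega>. (if failed n \<omega> then
      indicator {..X n \<omega>} (\<tau> n \<omega>) * \<phi> (clock n \<omega> + \<tau> n \<omega>) else 0) \<partial>M)"
    unfolding restart_integral_def
    by (intro nn_integral_cong) (auto simp: failed_def clock_def indicator_def less_Suc_eq)
  also have "\<dots> = restart_integral n (restart_step \<phi>)"
    unfolding restart_step_def[abs_def]
  proof (rule nn_integral_next_attempt)
    have "(\<lambda>(a, x, u). indicator {..x} u * \<phi> (a + u)) =
        (\<lambda>z. if snd (snd z) \<le> fst (snd z) then \<phi> (fst z + snd (snd z)) else 0)"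
      by (auto simp: indicator_def)
    also have "\<dots> \<in> borel_measurable (borel \<Otimes>\<^sub>M borel \<Otimes>\<^sub>M borel)"
      by measurable
    finally show "(\<lambda>(a, x, u). indicator {..x} u * \<phi> (a + u)) \<in> borel_measurable (borel \<Otimes>\<^sub>M borel \<Otimes>\<^sub>M borel)" .
  qed
  finally show ?thesis .
qed

lemma restart_integral_mono:
  "(\<And>a. \<phi> a \<le> \<psi> a) \<Longrightarrow> restart_integral n \<phi> \<le> restart_integral n \<psi>"
  unfolding restart_integral_def by (intro nn_integral_mono) auto

lemma restart_integral_add:
  assumes [measurable]: "\<phi> \<in> borel_measurable borel" "\<psi> \<in> borel_measurable borel"
  shows "restart_integral n (\<lambda>a. \<phi> a + \<psi> a) = restart_integral n \<phi> + restart_integral n \<psi>"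
  unfolding restart_integral_def by (subst nn_integral_add[symmetric]) (auto intro!: nn_integral_cong)

lemma restart_integral_cmult:
  assumes [measurable]: "\<phi> \<in> borel_measurable borel"
  shows "restart_integral n (\<lambda>a. c * \<phi> a) = c * restart_integral n \<phi>"
  unfolding restart_integral_def by (subst nn_integral_cmult[symmetric]) (auto intro!: nn_integral_cong)

lemma restart_step_const: "restart_step (\<lambda>_. c) = (\<lambda>_. c * ennreal (1 - L r))"
proof
  fix a
  have "restart_step (\<lambda>_. c) a = (\<integral>\<^sup>+x. c * emeasure (exp_dist r) {..x} \<partial>\<mu>)"
    unfolding restart_step_def by (simp add: mult.commute nn_integral_cmult_indicator)
  also have "\<dots> = (\<integral>\<^sup>+x. c * ennreal (1 * (1 - exp (- r * x))) \<partial>\<mu>)"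
    using positive by (intro nn_integral_cong_AE) (auto simp: emeasure_exp_dist_atMost[OF r_pos] elim!: eventually_mono)
  also have "\<dots> = c * ennreal (1 - L r)"
    using r_pos nn_integral_1_minus_exp[of r 1] by (simp add: nn_integral_cmult)
  finally show "restart_step (\<lambda>_. c) a = c * ennreal (1 - L r)" .
qed

lemma restart_integral_const: "restart_integral n (\<lambda>_. c) = c * ennreal ((1 - L r) ^ n)"
proof (induction n arbitrary: c)
  case (Suc n)
  show ?case
    using L_le_1[of r] r_pos
    by (simp add: restart_integral_Suc restart_step_const Suc ennreal_mult[symmetric] mult.assoc)
qed simp

text \<open>The first \<open>N\<close> terms plus \<open>restart_integral N \<phi>\<close> never
  exceed \<open>\<phi> 0\<close>: each use of the hypothesis splits one more term off the remainder,
  which is finally dropped.\<close>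

lemma super_solution:
  assumes [measurable]: "\<phi> \<in> borel_measurable borel" "g \<in> borel_measurable borel"
    and le: "\<And>a. g a + restart_step \<phi> a \<le> \<phi> a"
  shows "(\<Sum>n. restart_integral n g) \<le> \<phi> 0"
proof (rule suminf_le_const)
  fix N
  have "(\<Sum>n<N. restart_integral n g) + restart_integral N \<phi> \<le> \<phi> 0"
  proof (induction N)
    case (Suc N)
    have "(\<Sum>n<Suc N. restart_integral n g) + restart_integral (Suc N) \<phi> =
        (\<Sum>n<N. restart_integral n g) + restart_integral N (\<lambda>a. g a + restart_step \<phi> a)"
      by (simp add: restart_integral_add restart_integral_Suc add.assoc)
    also have "\<dots> \<le> (\<Sum>n<N. restart_integral n g) + restart_integral N \<phi>"
      by (intro add_left_mono restart_integral_mono le)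
    also note Suc
    finally show ?case .
  qed simp
  then show "(\<Sum>n<N. restart_integral n g) \<le> \<phi> 0"
    by (rule order_trans[rotated]) simp
qed simp

text \<open>The invariant of \<open>super_solution\<close> holds with reversed inequality. Here the
  remainder cannot be dropped; as \<open>\<phi> \<le> 1\<close>, it is at most
  \<open>(1 - L r) ^ N\<close>, which tends to 0.\<close>

lemma sub_solution:
  assumes [measurable]: "\<phi> \<in> borel_measurable borel" "g \<in> borel_measurable borel"
    and le: "\<And>a. \<phi> a \<le> g a + restart_step \<phi> a" and bound: "\<And>a. \<phi> a \<le> 1"
  shows "\<phi> 0 \<le> (\<Sum>n. restart_integral n g)"
proof -
  have 1: "\<phi> 0 \<le> (\<Sum>n<N. restart_integral n g) + restart_integral N \<phi>" for N
  proof (induction N)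
    case (Suc N)
    have "(\<Sum>n<Suc N. restart_integral n g) + restart_integral (Suc N) \<phi> =
        (\<Sum>n<N. restart_integral n g) + restart_integral N (\<lambda>a. g a + restart_step \<phi> a)"
      by (simp add: restart_integral_add restart_integral_Suc add.assoc)
    also have "\<dots> \<ge> (\<Sum>n<N. restart_integral n g) + restart_integral N \<phi>"
      by (intro add_left_mono restart_integral_mono le)
    finally show ?case by (rule order_trans[OF Suc])
  qed simp
  have "\<phi> 0 \<le> (\<Sum>n. restart_integral n g) + ennreal ((1 - L r) ^ N)" for N
  proof -
    have "\<phi> 0 \<le> (\<Sum>n<N. restart_integral n g) + restart_integral N \<phi>" by (rule 1)
    also have "\<dots> \<le> (\<Sum>n. restart_integral n g) + restart_integral N (\<lambda>_. 1)"
      by (intro add_mono restart_integral_mono bound sum_le_suminf) auto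
    finally show ?thesis by (simp add: restart_integral_const)
  qed
  moreover have "(\<lambda>N. (\<Sum>n. restart_integral n g) + ennreal ((1 - L r) ^ N)) \<longlonglongrightarrow>
      (\<Sum>n. restart_integral n g) + ennreal 0"
    using L_le_1[of r] L_pos[of r] r_pos
    by (intro tendsto_add tendsto_const tendsto_ennrealI LIMSEQ_realpow_zero) auto
  ultimately show ?thesis
    using LIMSEQ_le_const by fastforce
qed

section \<open>Exponential bounds for the time of the last catastrophe\<close>

text \<open>\<open>L r * renewal_tail s\<close> is the probability that the last catastrophe occurs after time \<open>s\<close>.\<close>

definition renewal_tail :: "real \<Rightarrow> ennreal" where
  "renewal_tail s = (\<Sum>n. restart_integral n (\<lambda>a. indicator {s<..} a))"

lemma ennreal_L_renewal_tail:
  "ennreal (L r) * renewal_tail s = (\<Sum>n. restart_integral n (\<lambda>a. ennreal (L r) * indicator {s<..} a))"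
  unfolding renewal_tail_def by (simp add: restart_integral_cmult)

text \<open>The function \<open>min 1 (exp (- a * (s - y)))\<close> of the current clock
  \<open>y\<close> is a supersolution. Beyond \<open>s\<close> it is 1 and the equation is exact;
  below \<open>s\<close>, one step multiplies the exponential by at most
  \<open>r / (r - a) * (1 - L (r - a))\<close>.\<close>

lemma renewal_tail_le:
  assumes a: "0 \<le> a" "a < r" and la: "a / r \<le> L (r - a)"
  shows "ennreal (L r) * renewal_tail s \<le> ennreal (exp (- a * s))"
proof -
  let ?h = "\<lambda>s. min 1 (exp (- a * s))"
  have "ennreal (L r) * renewal_tail s \<le> ennreal (?h (s - 0))"
    unfolding ennreal_L_renewal_tail
  proof (rule super_solution)
    fix y
    let ?\<phi> = "\<lambda>a. ennreal (?h (s - a))"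
    show "ennreal (L r) * indicator {s<..} y + restart_step ?\<phi> y \<le> ?\<phi> y"
    proof (cases "s < y")
      case True
      have "restart_step ?\<phi> y \<le> restart_step (\<lambda>_. 1) y"
        unfolding restart_step_def by (intro nn_integral_mono mult_left_mono) auto
      also have "\<dots> = ennreal (1 - L r)"
        by (simp add: restart_step_const)
      finally have "ennreal (L r) * indicator {s<..} y + restart_step ?\<phi> y \<le> ennreal (L r) + ennreal (1 - L r)"
        using True by simp
      also have "\<dots> = 1"
        using L_pos[of r] L_le_1[of r] r_pos by (subst ennreal_plus[symmetric]) auto
      also have "1 = ?\<phi> y"
        using True a by (simp add: min_def mult_le_0_iff)
      finally show ?thesis .
    next
      case False
      let ?c = "r / (r - a)"
      have "restart_step ?\<phi> y \<le> (\<integral>\<^sup>+x. \<integral>\<^sup>+u. indicator {..x} u * ennreal (exp (- a * (s - (y + u)))) \<partial>exp_dist r \<partial>\<mu>)"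
        unfolding restart_step_def by (intro nn_integral_mono mult_left_mono ennreal_leI) auto
      also have "\<dots> = (\<integral>\<^sup>+x. ennreal (exp (- a * (s - y))) * ennreal (?c * (1 - exp (- (r - a) * x))) \<partial>\<mu>)"
      proof (rule nn_integral_cong_AE, use positive in eventually_elim)
        fix x :: real assume x: "0 < x"
        have "(\<integral>\<^sup>+u. indicator {..x} u * ennreal (exp (- a * (s - (y + u)))) \<partial>exp_dist r) =
            (\<integral>\<^sup>+u. ennreal (exp (- a * (s - y))) * (ennreal (exp (a * u)) * indicator {0<..x} u) \<partial>exp_dist r)"
          by (rule nn_integral_cong_AE, use AE_exp_dist_pos[of r] in eventually_elim)
            (auto simp: indicator_def ennreal_mult[symmetric] exp_add[symmetric] algebra_simps)
        also have "\<dots> = ennreal (exp (- a * (s - y))) * ennreal (?c * (1 - exp (- (r - a) * x)))"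
          using nn_integral_exp_dist_Ioc[OF r_pos a(2), of 0 x] x by (subst nn_integral_cmult) auto
        finally show "(\<integral>\<^sup>+u. indicator {..x} u * ennreal (exp (- a * (s - (y + u)))) \<partial>exp_dist r) = \<dots>" .
      qed
      also have "\<dots> = ennreal (exp (- a * (s - y))) * ennreal (?c * (1 - L (r - a)))"
        using a r_pos nn_integral_1_minus_exp[of "r - a" ?c] by (simp add: nn_integral_cmult)
      also have "\<dots> \<le> ennreal (exp (- a * (s - y))) * ennreal 1"
      proof (intro mult_left_mono ennreal_leI)
        \<comment> \<open>The hypothesis \<open>la\<close> says precisely that the one-step factor
          is at most 1.\<close>
        have "1 - L (r - a) \<le> (r - a) / r"
          using la r_pos by (simp add: field_simps)
        then show "?c * (1 - L (r - a)) \<le> 1"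
          using a by (simp add: field_simps)
      qed auto
      also have "\<dots> = ?\<phi> y"
        using False a by (simp add: min_def mult_le_0_iff)
      finally show ?thesis
        using False by simp
    qed
  qed auto
  also have "\<dots> \<le> ennreal (exp (- a * s))"
    by (intro ennreal_leI) simp
  finally show ?thesis .
qed

text \<open>A function with a jump at level \<open>s\<close>, equal to 1 beyond it, serves as
  subsolution. The truncation \<open>max s 0\<close> makes the bound usable when the successful
  attempt alone outlasts the time under consideration.\<close>

lemma renewal_tail_ge:
  assumes b: "0 \<le> b" "b < r" and lb: "L (r - b) \<le> b / r"
  shows "ennreal ((1 - b / r) * exp (- b * max s 0)) \<le> ennreal (L r) * renewal_tail s"
proof -
  define c where "c = 1 - b / r"
  \<comment> \<open>The factor \<open>c\<close> compensates the overshoot over \<open>s\<close>, which is stochastically at most exponential with rate \<open>r\<close>.\<close>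
  define h where "h = (\<lambda>s. if s < 0 then 1 else c * exp (- b * s))"
  have c: "0 < c" "c \<le> 1" "c = (r - b) / r"
    using b r_pos by (auto simp: c_def field_simps)
  have h01: "0 \<le> h s" "h s \<le> 1" for s
    using c(1,2) b by (auto simp: h_def intro!: mult_le_one)
  have [measurable]: "h \<in> borel_measurable borel"
    unfolding h_def by measurable
  have "c * exp (- b * max s 0) \<le> h s"
    using c by (auto simp: h_def max_def)
  then have "ennreal ((1 - b / r) * exp (- b * max s 0)) \<le> ennreal (h (s - 0))"
    unfolding c_def by (simp add: ennreal_leI)
  also have "\<dots> \<le> ennreal (L r) * renewal_tail s"
    unfolding ennreal_L_renewal_tail
  proof (rule sub_solution)
    fix y
    let ?\<phi> = "\<lambda>a. ennreal (h (s - a))"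
    show "?\<phi> y \<le> ennreal (L r) * indicator {s<..} y + restart_step ?\<phi> y"
    proof (cases "s < y")
      case True
      have "?\<phi> y = 1"
        using True by (simp add: h_def)
      also have "1 = ennreal (L r) + ennreal (1 - L r)"
        using L_pos[of r] L_le_1[of r] r_pos by (subst ennreal_plus[symmetric]) auto
      also have "ennreal (1 - L r) = restart_step (\<lambda>_. 1) y"
        by (simp add: restart_step_const)
      also have "\<dots> = restart_step ?\<phi> y"
        unfolding restart_step_def
        by (rule nn_integral_cong, rule nn_integral_cong_AE, use AE_exp_dist_pos[of r] in eventually_elim)
          (use True in \<open>simp add: h_def\<close>)
      finally show ?thesis
        using True by simp
    next
      case False
      define w where "w = s - y"
      have w: "0 \<le> w" using False by (simp add: w_def)
      \<comment> \<open>One step for a fixed base time \<open>x\<close>: catastrophes up to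
        \<open>min x w\<close> are weighted with the exponential branch of \<open>h\<close>, those
        in \<open>{w<..x}\<close> with its value 1.\<close>
      have bd: "ennreal (exp (- b * w) * (1 - exp (- (r - b) * x))) \<le>
          (\<integral>\<^sup>+u. indicator {..x} u * ?\<phi> (y + u) \<partial>exp_dist r)" if x: "0 < x" for x
      proof -
        let ?m = "min x w"
        have m: "0 \<le> ?m" "?m \<le> x" using w x by auto
        have "ennreal (exp (- b * w) * (1 - exp (- (r - b) * x))) \<le>
            ennreal (exp (- b * w) * (1 - exp (- (r - b) * ?m)) + (exp (- r * ?m) - exp (- r * x)))"
        proof (rule ennreal_leI, cases "x \<le> w")
          case False
          \<comment> \<open>After cancellation the claim is
            \<open>exp (- r * x) \<le> exp (- b * w) * exp (- (r - b) * x)\<close>, which holds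
            because \<open>w \<le> x\<close>.\<close>
          have "b * w + (r - b) * x \<le> r * x"
            using False b by (simp add: algebra_simps mult_left_mono)
          then have "exp (- r * x) \<le> exp (- b * w + - (r - b) * x)"
            by (simp add: algebra_simps)
          moreover have "exp (- b * w) * exp (- (r - b) * w) = exp (- r * w)"
            by (simp add: exp_add[symmetric] algebra_simps)
          ultimately show "exp (- b * w) * (1 - exp (- (r - b) * x)) \<le>
            exp (- b * w) * (1 - exp (- (r - b) * ?m)) + (exp (- r * ?m) - exp (- r * x))"
            using False by (simp add: exp_add[symmetric] min_def algebra_simps)
        qed (simp add: min_def)
        also have "\<dots> = ennreal (c * exp (- b * w)) * ennreal (r / (r - b) * (1 - exp (- (r - b) * ?m))) +
            ennreal (exp (- r * ?m) - exp (- r * x))"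
        proof -
          have "exp (- r * x) \<le> exp (- r * ?m)" "exp (- (r - b) * ?m) \<le> 1"
            using r_pos m b by (auto simp del: min_less_iff_conj intro: mult_nonpos_nonneg)
          moreover have "exp (- b * w) * (1 - exp (- (r - b) * ?m)) =
              (c * exp (- b * w)) * (r / (r - b) * (1 - exp (- (r - b) * ?m)))"
            using b r_pos by (simp add: c(3))
          ultimately show ?thesis
            using b r_pos c by (simp add: ennreal_mult[symmetric])
        qed
        also have "\<dots> = (\<integral>\<^sup>+u. ennreal (c * exp (- b * w)) * (ennreal (exp (b * u)) * indicator {0<..?m} u)
            + indicator {?m<..x} u \<partial>exp_dist r)"
          using nn_integral_exp_dist_Ioc[OF r_pos b(2), of 0 ?m] emeasure_exp_dist_Ioc[OF r_pos m] m
          by (subst nn_integral_add) (auto simp: nn_integral_cmult)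
        also have "\<dots> \<le> (\<integral>\<^sup>+u. indicator {..x} u * ?\<phi> (y + u) \<partial>exp_dist r)"
          using c(1) by (intro nn_integral_mono)
            (auto simp: h_def w_def indicator_def ennreal_mult[symmetric] exp_add[symmetric] algebra_simps)
        finally show ?thesis .
      qed
      have "?\<phi> y \<le> ennreal (exp (- b * w) * (1 - L (r - b)))"
      proof (rule ennreal_leI)
        \<comment> \<open>This is where \<open>lb\<close> enters: the mass of the tilted step makes
          up for the factor \<open>c\<close> in \<open>h\<close>.\<close>
        have "c \<le> 1 - L (r - b)"
          using lb by (simp add: c_def)
        then show "h (s - y) \<le> exp (- b * w) * (1 - L (r - b))"
          using False by (simp add: h_def w_def mult.commute)
      qed
      also have "\<dots> = (\<integral>\<^sup>+x. ennreal (exp (- b * w) * (1 - exp (- (r - b) * x))) \<partial>\<mu>)"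
        using b by (intro nn_integral_1_minus_exp[symmetric]) auto
      also have "\<dots> \<le> restart_step ?\<phi> y"
        unfolding restart_step_def
        by (rule nn_integral_mono_AE, use positive in eventually_elim) (rule bd)
      finally show ?thesis
        by (simp add: False)
    qed
  qed (use h01 in auto)
  finally show ?thesis .
qed

section \<open>Law and mean of the completion time\<close>

lemma measurable_completion_time [measurable]: "completion_time X \<tau> \<in> borel_measurable M"
proof -
  have [measurable]: "(\<lambda>\<omega>. \<Sum>n\<le>(LEAST n. X n \<omega> < \<tau> n \<omega>). min (X n \<omega>) (\<tau> n \<omega>)) \<in> borel_measurable M"
    by (rule measurable_compose_countable) measurable
  show ?thesis
    unfolding completion_time_def[abs_def] by measurable
qed

section \<open>Almost sure success and decomposition at the first success\<close>

lemma AE_attempt_pos: "AE \<omega> in M. \<forall>n. 0 < X n \<omega> \<and> 0 < \<tau> n \<omega>"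
proof -
  have "AE \<omega> in M. 0 < X n \<omega>" for n
    using positive unfolding distr_X[of n, symmetric] by (subst (asm) AE_distr_iff) auto
  moreover have "AE \<omega> in M. 0 < \<tau> n \<omega>" for n
    using AE_exp_dist_pos[of r] unfolding distr_tau[of n, symmetric] by (subst (asm) AE_distr_iff) auto
  ultimately show ?thesis
    unfolding AE_all_countable by auto
qed

text \<open>Perpetual failure lies in \<open>failed n\<close> for every \<open>n\<close>, an event
  of probability \<open>(1 - L r) ^ n\<close>.\<close>

lemma AE_success: "AE \<omega> in M. \<exists>n. X n \<omega> < \<tau> n \<omega>"
proof -
  let ?N = "{\<omega>\<in>space M. \<forall>n. \<tau> n \<omega> \<le> X n \<omega>}"
  have "emeasure M ?N \<le> ennreal ((1 - L r) ^ n)" for n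
  proof -
    have "emeasure M ?N \<le> emeasure M {\<omega>\<in>space M. failed n \<omega>}"
      by (intro emeasure_mono) (auto simp: failed_def)
    also have "\<dots> = restart_integral n (\<lambda>_. 1)"
    proof -
      have "restart_integral n (\<lambda>_. 1) = (\<integral>\<^sup>+\<omega>. indicator {\<omega>\<in>space M. failed n \<omega>} \<omega> \<partial>M)"
        unfolding restart_integral_def by (intro nn_integral_cong) (auto simp: indicator_def)
      then show ?thesis by simp
    qed
    finally show ?thesis by (simp add: restart_integral_const)
  qed
  moreover have "(\<lambda>n. ennreal ((1 - L r) ^ n)) \<longlonglongrightarrow> ennreal 0"
    using L_le_1[of r] L_pos[of r] r_pos
    by (intro tendsto_ennrealI LIMSEQ_realpow_zero) auto
  ultimately have "emeasure M ?N \<le> ennreal 0"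
    using LIMSEQ_le_const by fastforce
  then have "AE \<omega> in M. \<not> (\<forall>n. \<tau> n \<omega> \<le> X n \<omega>)"
    by (intro AE_I[of _ _ ?N]) auto
  then show ?thesis by (auto simp: not_le)
qed

lemma completion_time_first_success:
  assumes "X n \<omega> < \<tau> n \<omega>" "failed n \<omega>"
  shows "completion_time X \<tau> \<omega> = clock n \<omega> + X n \<omega>"
proof -
  have *: "(LEAST n. X n \<omega> < \<tau> n \<omega>) = n"
    using assms by (intro Least_equality) (auto simp: failed_def not_less[symmetric])
  have "(\<Sum>k<n. min (X k \<omega>) (\<tau> k \<omega>)) = (\<Sum>k<n. \<tau> k \<omega>)"
    using assms by (intro sum.cong) (auto simp: failed_def min_def)
  then show ?thesis
    using assms(1) by (auto simp: completion_time_def * clock_def lessThan_Suc_atMost[symmetric] min_def)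
qed

lemma first_success:
  assumes "\<exists>n. X n \<omega> < \<tau> n \<omega>"
  obtains n where "X n \<omega> < \<tau> n \<omega>" "failed n \<omega>"
proof (rule that)
  show "X (LEAST n. X n \<omega> < \<tau> n \<omega>) \<omega> < \<tau> (LEAST n. X n \<omega> < \<tau> n \<omega>) \<omega>"
    using assms by (auto intro: LeastI)
  show "failed (LEAST n. X n \<omega> < \<tau> n \<omega>) \<omega>"
    unfolding failed_def by (auto dest: not_less_Least simp: not_less)
qed

lemma failed_first_success_iff:
  assumes "X n \<omega> < \<tau> n \<omega>" "failed n \<omega>"
  shows "failed k \<omega> \<longleftrightarrow> k \<le> n"
  using assms unfolding failed_def by (meson leD le_trans less_le_trans not_le_imp_less)

lemma measurable_restart_integral_indicator [measurable]:
  "(\<lambda>s. restart_integral n (\<lambda>a. indicator {s<..} a)) \<in> borel_measurable borel"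
proof -
  have "(\<lambda>s. restart_integral n (\<lambda>a. indicator {s<..} a)) =
      (\<lambda>s. \<integral>\<^sup>+\<omega>. (if failed n \<omega> \<and> s < clock n \<omega> then 1 else 0) \<partial>M)"
    unfolding restart_integral_def by (auto intro!: nn_integral_cong simp: indicator_def)
  also have "\<dots> \<in> borel_measurable borel"
    by measurable
  finally show ?thesis .
qed

lemma measurable_renewal_tail [measurable]: "renewal_tail \<in> borel_measurable borel"
  unfolding renewal_tail_def[abs_def] by measurable

text \<open>Sum over the index of the successful attempt: given its base time \<open>x\<close>, it
  succeeds with probability \<open>exp (- r * x)\<close>, and it must have started after
  \<open>t - x\<close>. Interchanging sum and integrals produces
  \<open>renewal_tail\<close>.\<close>

lemma emeasure_completion_time_gt:
  "emeasure M {\<omega>\<in>space M. t < completion_time X \<tau> \<omega>} =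
    (\<integral>\<^sup>+x. ennreal (exp (- r * x)) * renewal_tail (t - x) \<partial>\<mu>)"
proof -
  let ?T = "completion_time X \<tau>"
  let ?\<psi> = "\<lambda>a x u. indicator {x<..} u * (indicator {t - x<..} a :: ennreal)"
  let ?f = "\<lambda>n \<omega>. if failed n \<omega> then ?\<psi> (clock n \<omega>) (X n \<omega>) (\<tau> n \<omega>) else 0"
  have if_eq: "?\<psi> a x u = (if x < u then if t - x < a then 1 else 0 else 0)" for a x u
    by (auto simp: indicator_def)
  \<comment> \<open>Only the first successful attempt contributes: an earlier one fails its own
    test, and a later one violates \<open>failed\<close>.\<close>
  have sum: "(\<Sum>n. ?f n \<omega>) = indicator {\<omega>\<in>space M. t < ?T \<omega>} \<omega>"
    if \<omega>: "\<omega> \<in> space M" "\<exists>n. X n \<omega> < \<tau> n \<omega>" for \<omega>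
  proof -
    obtain n where n: "X n \<omega> < \<tau> n \<omega>" "failed n \<omega>"
      using first_success \<omega>(2) by blast
    have "?f k \<omega> = 0" if "k \<noteq> n" for k
    proof (cases "k < n")
      case True
      then have "\<tau> k \<omega> \<le> X k \<omega>" using n(2) by (simp add: failed_def)
      then show ?thesis by simp
    next
      case False
      then show ?thesis using that failed_first_success_iff[OF n, of k] by simp
    qed
    then have "(\<Sum>n. ?f n \<omega>) = (\<Sum>k\<in>{n}. ?f k \<omega>)"
      by (intro suminf_finite) auto
    then show ?thesis
      using n \<omega> by (auto simp: indicator_def completion_time_first_success[OF n])
  qed
  have "emeasure M {\<omega>\<in>space M. t < ?T \<omega>} = (\<integral>\<^sup>+\<omega>. indicator {\<omega>\<in>space M. t < ?T \<omega>} \<omega> \<partial>M)"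
    by (intro nn_integral_indicator[symmetric]) measurable
  also have "\<dots> = (\<integral>\<^sup>+\<omega>. (\<Sum>n. ?f n \<omega>) \<partial>M)"
    by (rule nn_integral_cong_AE, use AE_success AE_space in eventually_elim) (simp only: sum)
  also have "\<dots> = (\<Sum>n. \<integral>\<^sup>+\<omega>. ?f n \<omega> \<partial>M)"
    unfolding if_eq by (rule nn_integral_suminf) measurable
  also have "\<dots> = (\<Sum>n. \<integral>\<^sup>+x. ennreal (exp (- r * x)) * restart_integral n (\<lambda>a. indicator {t - x<..} a) \<partial>\<mu>)"
  proof (rule suminf_cong)
    fix n
    have "(\<integral>\<^sup>+\<omega>. ?f n \<omega> \<partial>M) = restart_integral n (\<lambda>a. \<integral>\<^sup>+x. \<integral>\<^sup>+u. ?\<psi> a x u \<partial>exp_dist r \<partial>\<mu>)"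
      by (rule nn_integral_next_attempt) (unfold if_eq, measurable)
    also have "(\<lambda>a. \<integral>\<^sup>+x. \<integral>\<^sup>+u. ?\<psi> a x u \<partial>exp_dist r \<partial>\<mu>) =
        (\<lambda>a. \<integral>\<^sup>+x. ennreal (exp (- r * x)) * indicator {t - x<..} a \<partial>\<mu>)"
      by (rule ext, rule nn_integral_cong_AE, use positive in eventually_elim)
        (auto simp: nn_integral_multc emeasure_exp_dist_greaterThan[OF r_pos])
    also have "restart_integral n \<dots> = (\<integral>\<^sup>+\<omega>. \<integral>\<^sup>+x. (if failed n \<omega> \<and> t < clock n \<omega> + x then ennreal (exp (- r * x)) else 0) \<partial>\<mu> \<partial>M)"
      unfolding restart_integral_def by (auto intro!: nn_integral_cong simp: indicator_def)
    also have "\<dots> = (\<integral>\<^sup>+x. \<integral>\<^sup>+\<omega>. (if failed n \<omega> \<and> t < clock n \<omega> + x then ennreal (exp (- r * x)) else 0) \<partial>M \<partial>\<mu>)"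
    proof -
      interpret P: pair_sigma_finite M \<mu> ..
      show ?thesis by (rule P.Fubini'[symmetric]) measurable
    qed
    also have "\<dots> = (\<integral>\<^sup>+x. ennreal (exp (- r * x)) * restart_integral n (\<lambda>a. indicator {t - x<..} a) \<partial>\<mu>)"
      unfolding restart_integral_def
      by (subst nn_integral_cmult[symmetric])
        (auto intro!: nn_integral_cong simp: indicator_def)
    finally show "(\<integral>\<^sup>+\<omega>. ?f n \<omega> \<partial>M) = \<dots>" .
  qed
  also have "\<dots> = (\<integral>\<^sup>+x. (\<Sum>n. ennreal (exp (- r * x)) * restart_integral n (\<lambda>a. indicator {t - x<..} a)) \<partial>\<mu>)"
    by (rule nn_integral_suminf[symmetric]) measurable
  also have "\<dots> = (\<integral>\<^sup>+x. ennreal (exp (- r * x)) * renewal_tail (t - x) \<partial>\<mu>)"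
    unfolding renewal_tail_def by simp
  finally show ?thesis .
qed

lemma AE_completion_time_nonneg: "AE \<omega> in M. 0 \<le> completion_time X \<tau> \<omega>"
  using AE_attempt_pos
  by eventually_elim (auto simp: completion_time_def less_imp_le intro!: sum_nonneg)

text \<open>Attempt \<open>n\<close> takes place exactly when all earlier ones fail. Independence
  gives it the contribution \<open>(1 - L r) / r * (1 - L r) ^ n\<close>, and the series is
  geometric.\<close>

lemma expectation_completion_time: "expectation (completion_time X \<tau>) = (1 - L r) / (r * L r)"
proof -
  let ?T = "completion_time X \<tau>"
  let ?f = "\<lambda>n \<omega>. if failed n \<omega> then ennreal (min (X n \<omega>) (\<tau> n \<omega>)) else 0"
  have sum: "(\<Sum>n. ?f n \<omega>) = ennreal (?T \<omega>)"
    if \<omega>: "\<forall>n. 0 < X n \<omega> \<and> 0 < \<tau> n \<omega>" "\<exists>n. X n \<omega> < \<tau> n \<omega>" for \<omega>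
  proof -
    obtain n where n: "X n \<omega> < \<tau> n \<omega>" "failed n \<omega>"
      using first_success \<omega>(2) by blast
    have "?f k \<omega> = 0" if "k \<notin> {..n}" for k
      using that failed_first_success_iff[OF n, of k] by auto
    then have "(\<Sum>n. ?f n \<omega>) = (\<Sum>k\<le>n. ?f k \<omega>)"
      by (intro suminf_finite) auto
    also have "\<dots> = (\<Sum>k<n. ennreal (\<tau> k \<omega>)) + ennreal (X n \<omega>)"
    proof -
      have "(\<Sum>k<n. ?f k \<omega>) = (\<Sum>k<n. ennreal (\<tau> k \<omega>))"
      proof (intro sum.cong refl)
        fix k assume "k \<in> {..<n}"
        then have "failed k \<omega>" "\<tau> k \<omega> \<le> X k \<omega>"
          using n(2) failed_first_success_iff[OF n, of k] by (auto simp: failed_def)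
        then show "?f k \<omega> = ennreal (\<tau> k \<omega>)" by simp
      qed
      then show ?thesis
        using n by (simp add: lessThan_Suc_atMost[symmetric] min_def)
    qed
    also have "\<dots> = ennreal (clock n \<omega> + X n \<omega>)"
      using \<omega>(1) by (simp add: clock_def less_imp_le sum_nonneg)
    finally show ?thesis
      by (simp add: completion_time_first_success[OF n])
  qed
  have ae: "AE \<omega> in M. (\<Sum>n. ?f n \<omega>) = ennreal (?T \<omega>)"
    using AE_success AE_attempt_pos by eventually_elim (use sum in blast)
  have "(\<integral>\<^sup>+\<omega>. ennreal (?T \<omega>) \<partial>M) = (\<integral>\<^sup>+\<omega>. (\<Sum>n. ?f n \<omega>) \<partial>M)"
    by (rule nn_integral_cong_AE, use ae in eventually_elim) simp
  also have "\<dots> = (\<Sum>n. \<integral>\<^sup>+\<omega>. ?f n \<omega> \<partial>M)"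
    by (rule nn_integral_suminf) measurable
  also have "\<dots> = (\<Sum>n. ennreal ((1 - L r) / r) * ennreal ((1 - L r) ^ n))"
  proof (rule suminf_cong)
    fix n
    have "(\<integral>\<^sup>+\<omega>. ?f n \<omega> \<partial>M) = restart_integral n (\<lambda>a. \<integral>\<^sup>+x. \<integral>\<^sup>+u. ennreal (min x u) \<partial>exp_dist r \<partial>\<mu>)"
      by (rule nn_integral_next_attempt) measurable
    also have "(\<lambda>a::real. \<integral>\<^sup>+x. \<integral>\<^sup>+u. ennreal (min x u) \<partial>exp_dist r \<partial>\<mu>) =
        (\<lambda>a. \<integral>\<^sup>+x. ennreal (1 / r * (1 - exp (- r * x))) \<partial>\<mu>)"
      by (rule ext, rule nn_integral_cong_AE, use positive in eventually_elim)
        (simp add: nn_integral_exp_dist_min[OF r_pos])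
    also have "\<dots> = (\<lambda>a. ennreal ((1 - L r) / r))"
      using nn_integral_1_minus_exp[of r "1 / r"] r_pos by simp
    finally show "(\<integral>\<^sup>+\<omega>. ?f n \<omega> \<partial>M) = ennreal ((1 - L r) / r) * ennreal ((1 - L r) ^ n)"
      by (simp add: restart_integral_const)
  qed
  also have "\<dots> = (\<Sum>n. ennreal ((1 - L r) / r * (1 - L r) ^ n))"
    using L_le_1[of r] r_pos by (intro suminf_cong ennreal_mult[symmetric]) auto
  also have "\<dots> = ennreal ((1 - L r) / r * (1 / (1 - (1 - L r))))"
  proof (rule suminf_ennreal_eq)
    show "(\<lambda>n. (1 - L r) / r * (1 - L r) ^ n) sums ((1 - L r) / r * (1 / (1 - (1 - L r))))"
      using L_le_1[of r] L_pos[of r] r_pos by (intro sums_mult geometric_sums) auto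
  qed (use L_le_1[of r] r_pos in auto)
  finally have "(\<integral>\<^sup>+\<omega>. ennreal (?T \<omega>) \<partial>M) = ennreal ((1 - L r) / (r * L r))"
    by simp
  moreover have "expectation ?T = enn2real (\<integral>\<^sup>+\<omega>. ennreal (?T \<omega>) \<partial>M)"
    by (rule integral_eq_nn_integral) (use AE_completion_time_nonneg in auto)
  ultimately show ?thesis
    using L_le_1[of r] L_pos[of r] r_pos by simp
qed

end

section \<open>Bounds for the tail of the completion time\<close>

lemma mult_exp_minus_le:
  fixes y :: real
  assumes "0 \<le> y"
  shows "y * exp (- y) \<le> 1 / 2" "y\<^sup>2 * exp (- y) \<le> 2"
proof -
  have e: "1 + y + y\<^sup>2 / 2 \<le> exp y"
    by (rule exp_lower_Taylor_quadratic) fact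
  have "0 \<le> (y - 1)\<^sup>2" by simp
  then have "2 * y \<le> exp y"
    using e assms by (simp add: power2_diff)
  then show "y * exp (- y) \<le> 1 / 2"
    by (simp add: exp_minus field_simps)
  have "y\<^sup>2 \<le> 2 * exp y"
    using e assms by linarith
  then show "y\<^sup>2 * exp (- y) \<le> 2"
    by (simp add: exp_minus field_simps)
qed

text \<open>The Taylor remainder costs a factor \<open>exp (r * x / 2)\<close>, since
  \<open>\<bar>h\<bar> \<le> r / 2\<close>. The remaining \<open>exp (- (r * x / 2))\<close> absorbs
  the factor x^2, so the bound is uniform in \<open>x\<close>.\<close>

lemma exp_minus_Taylor_bound:
  fixes r h x :: real
  assumes r: "0 < r" and h: "\<bar>h\<bar> \<le> r / 2" and x: "0 \<le> x"
  shows "\<bar>exp (- (r + h) * x) - exp (- r * x) + h * (x * exp (- r * x))\<bar> \<le> 8 * (h / r)\<^sup>2"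
proof -
  have "\<bar>exp (- (h * x)) - (1 - h * x)\<bar> \<le> exp \<bar>h * x\<bar> * (h * x)\<^sup>2"
    using Taylor_exp_field[of "- (h * x)" 1] by (simp add: power2_eq_square)
  moreover have "exp \<bar>h * x\<bar> \<le> exp (r * x / 2)"
    using mult_right_mono[OF h x] x by (simp add: abs_mult)
  ultimately have 1: "\<bar>exp (- (h * x)) - (1 - h * x)\<bar> \<le> exp (r * x / 2) * (h * x)\<^sup>2"
    by (smt (verit) mult_right_mono zero_le_power2)
  have "\<bar>exp (- (r + h) * x) - exp (- r * x) + h * (x * exp (- r * x))\<bar> =
      \<bar>exp (- r * x) * (exp (- (h * x)) - (1 - h * x))\<bar>"
    by (simp add: algebra_simps exp_add[symmetric])
  also have "\<dots> = exp (- r * x) * \<bar>exp (- (h * x)) - (1 - h * x)\<bar>"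
    by (simp add: abs_mult)
  also have "\<dots> \<le> exp (- r * x) * (exp (r * x / 2) * (h * x)\<^sup>2)"
    by (intro mult_left_mono 1) auto
  also have "\<dots> = exp (- (r * x / 2)) * (h * x)\<^sup>2"
    by (simp add: mult.assoc[symmetric] exp_add[symmetric])
  \<comment> \<open>Written in terms of \<open>y = r * x / 2\<close>, so that y^2 exp(-y) is at most
    2; hence the constant 8.\<close>
  also have "\<dots> = 4 * (h / r)\<^sup>2 * ((r * x / 2)\<^sup>2 * exp (- (r * x / 2)))"
    using r by (simp add: field_simps power2_eq_square)
  also have "\<dots> \<le> 4 * (h / r)\<^sup>2 * 2"
    using r x by (intro mult_left_mono mult_exp_minus_le) auto
  finally show ?thesis by simp
qed

section \<open>Expansion of the Laplace transform at the resetting rate\<close>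

context positive_resetting
begin

text \<open>This is minus the derivative of \<open>L\<close> at \<open>r\<close>, see
  \<open>deriv_L\<close>, and \<open>D = r * tilted_mean\<close>. The exponential weight keeps it
  finite even if the base time has infinite mean.\<close>

definition tilted_mean :: real where
  "tilted_mean = (\<integral>x. x * exp (- r * x) \<partial>\<mu>)"

lemma integrable_tilted_mean: "integrable \<mu> (\<lambda>x. x * exp (- r * x))"
proof (rule base.integrable_const_bound[where B = "1 / (2 * r)"])
  show "AE x in \<mu>. norm (x * exp (- r * x)) \<le> 1 / (2 * r)"
    using positive
  proof eventually_elim
    case (elim x)
    then show ?case
      using mult_exp_minus_le(1)[of "r * x"] r_pos by (simp add: abs_mult field_simps)
  qed
qed measurable

lemma tilted_mean_nonneg: "0 \<le> tilted_mean"
  unfolding tilted_mean_def using positive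
  by (intro integral_nonneg_AE) (auto elim!: eventually_mono)

lemma tilted_mean_le: "r * tilted_mean \<le> 1 / 2"
proof -
  have "tilted_mean \<le> 1 / (2 * r)"
    unfolding tilted_mean_def
  proof (rule base.integral_le_const[OF integrable_tilted_mean])
    show "AE x in \<mu>. x * exp (- r * x) \<le> 1 / (2 * r)"
      using positive
    proof eventually_elim
      case (elim x)
      then show ?case
        using mult_exp_minus_le(1)[of "r * x"] r_pos by (simp add: field_simps)
    qed
  qed
  then show ?thesis
    using r_pos by (simp add: field_simps)
qed

text \<open>The pointwise bound is integrated. The constant does not depend on the law of the base
  time, which makes the later estimates uniform along the family.\<close>

lemma L_Taylor_bound:
  assumes h: "\<bar>h\<bar> \<le> r / 2"
  shows "\<bar>L (r + h) - L r + h * tilted_mean\<bar> \<le> 8 * (h / r)\<^sup>2"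
proof -
  let ?g = "\<lambda>x. exp (- (r + h) * x) - exp (- r * x) + h * (x * exp (- r * x))"
  have i: "integrable \<mu> (\<lambda>x. exp (- (r + h) * x))" "integrable \<mu> (\<lambda>x. exp (- r * x))"
      "integrable \<mu> (\<lambda>x. h * (x * exp (- r * x)))"
    using integrable_exp[of "r + h"] integrable_exp[of r] integrable_tilted_mean h r_pos by auto
  have ae: "AE x in \<mu>. \<bar>?g x\<bar> \<le> 8 * (h / r)\<^sup>2"
    using positive by eventually_elim (intro exp_minus_Taylor_bound r_pos h less_imp_le)
  have "(\<integral>x. ?g x \<partial>\<mu>) = L (r + h) - L r + h * tilted_mean"
    using i by (simp add: laplace_transform_def tilted_mean_def del: mult_minus_left minus_add_distrib)
  moreover have "\<bar>\<integral>x. ?g x \<partial>\<mu>\<bar> \<le> (\<integral>x. \<bar>?g x\<bar> \<partial>\<mu>)"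
    by (rule integral_abs_bound)
  moreover have "\<dots> \<le> 8 * (h / r)\<^sup>2"
    using i ae by (intro base.integral_le_const integrable_abs Bochner_Integration.integrable_add Bochner_Integration.integrable_diff) auto
  ultimately show ?thesis by simp
qed

lemma deriv_L: "deriv L r = - tilted_mean"
proof (rule DERIV_imp_deriv)
  have "((\<lambda>h. (L (r + h) - L r) / h - (- tilted_mean)) \<longlongrightarrow> 0) (at 0)"
  proof (rule Lim_null_comparison)
    have "\<forall>\<^sub>F h in at 0. \<bar>h\<bar> < r / 2"
      unfolding eventually_at dist_real_def using r_pos by (intro exI[of _ "r / 2"]) auto
    moreover have "\<forall>\<^sub>F h in at 0. h \<noteq> (0::real)"
      by (simp add: eventually_at_filter)
    ultimately show "\<forall>\<^sub>F h in at 0. norm ((L (r + h) - L r) / h - (- tilted_mean)) \<le> 8 / r\<^sup>2 * \<bar>h\<bar>"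
    proof eventually_elim
      case (elim h)
      have "(L (r + h) - L r) / h - (- tilted_mean) = (L (r + h) - L r + h * tilted_mean) / h"
        using elim by (simp add: add_divide_distrib)
      then have "norm ((L (r + h) - L r) / h - (- tilted_mean)) = \<bar>L (r + h) - L r + h * tilted_mean\<bar> / \<bar>h\<bar>"
        by (simp only: real_norm_def abs_divide)
      also have "\<dots> \<le> (8 * (h / r)\<^sup>2) / \<bar>h\<bar>"
        using elim by (intro divide_right_mono L_Taylor_bound) auto
      also have "\<dots> = 8 / r\<^sup>2 * \<bar>h\<bar>"
        using elim by (simp add: field_simps power2_eq_square)
      finally show ?case .
    qed
    show "((\<lambda>h. 8 / r\<^sup>2 * \<bar>h\<bar>) \<longlongrightarrow> 0) (at 0)"
      using r_pos by (auto intro!: tendsto_eq_intros)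
  qed
  then show "DERIV L r :> - tilted_mean"
    unfolding DERIV_def by (rule LIM_zero_cancel)
qed

lemma L_antimono:
  assumes "0 \<le> l" "l \<le> l'"
  shows "L l' \<le> L l"
  unfolding laplace_transform_def
  by (intro integral_mono_AE integrable_exp) (use positive assms in \<open>auto elim!: eventually_mono\<close>)

section \<open>From the last catastrophe to the completion time\<close>

abbreviation "T \<equiv> completion_time X \<tau>"

text \<open>The factor \<open>L r\<close> is kept because the exponential bounds concern
  \<open>L r * renewal_tail\<close>.\<close>

lemma L_times_prob_gt:
  "ennreal (L r * prob {\<omega>\<in>space M. t < T \<omega>}) =
    (\<integral>\<^sup>+x. ennreal (exp (- r * x)) * (ennreal (L r) * renewal_tail (t - x)) \<partial>\<mu>)"
proof -
  have "(\<integral>\<^sup>+x. ennreal (exp (- r * x)) * (ennreal (L r) * renewal_tail (t - x)) \<partial>\<mu>) =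
      ennreal (L r) * emeasure M {\<omega>\<in>space M. t < T \<omega>}"
    unfolding emeasure_completion_time_gt
    by (subst nn_integral_cmult[symmetric]) (auto simp: mult.left_commute)
  then show ?thesis
    using L_pos[of r] r_pos by (simp add: emeasure_eq_measure ennreal_mult)
qed

text \<open>The bound of \<open>renewal_tail_le\<close> also holds at negative arguments, so it can
  be integrated over all \<open>x\<close>, and the weights combine to
  \<open>exp (- (r - a) * x)\<close>.\<close>

lemma prob_gt_le:
  assumes a: "0 \<le> a" "a < r" "a / r \<le> L (r - a)"
  shows "prob {\<omega>\<in>space M. t < T \<omega>} \<le> exp (- a * t) * (L (r - a) / L r)"
proof -
  have "ennreal (L r * prob {\<omega>\<in>space M. t < T \<omega>}) \<le>
      (\<integral>\<^sup>+x. ennreal (exp (- r * x)) * ennreal (exp (- a * (t - x))) \<partial>\<mu>)"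
    unfolding L_times_prob_gt by (intro nn_integral_mono mult_left_mono renewal_tail_le a) auto
  also have "\<dots> = (\<integral>\<^sup>+x. ennreal (exp (- a * t)) * ennreal (exp (- (r - a) * x)) \<partial>\<mu>)"
    by (intro nn_integral_cong) (simp add: ennreal_mult[symmetric] exp_add[symmetric] algebra_simps)
  also have "\<dots> = ennreal (exp (- a * t) * L (r - a))"
    using a L_pos[of "r - a"] nn_integral_exp[of "r - a"] by (subst nn_integral_cmult) (auto simp: ennreal_mult)
  finally have "L r * prob {\<omega>\<in>space M. t < T \<omega>} \<le> exp (- a * t) * L (r - a)"
    using a L_pos[of "r - a"] by (simp add: ennreal_le_iff)
  then show ?thesis
    using L_pos[of r] r_pos by (simp add: field_simps)
qed

lemma integrable_min_exp:
  assumes "0 \<le> t"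
  shows "integrable \<mu> (\<lambda>x. min x t * exp (- r * x))"
  by (rule Bochner_Integration.integrable_bound[OF integrable_tilted_mean])
    (use positive assms in \<open>auto elim!: eventually_mono simp: abs_mult\<close>)

text \<open>The integral of \<open>min x t\<close> records the delay due to the successful attempt;
  it is the source of the excess of order \<open>D\<close> in the lower bound for the
  distance.\<close>

lemma prob_gt_ge:
  assumes b: "0 \<le> b" "b < r" "L (r - b) \<le> b / r" and t: "0 \<le> t"
  shows "(1 - b / r) * exp (- b * t) * (1 + b / L r * (\<integral>x. min x t * exp (- r * x) \<partial>\<mu>))
    \<le> prob {\<omega>\<in>space M. t < T \<omega>}"
proof -
  let ?J = "\<integral>x. min x t * exp (- r * x) \<partial>\<mu>"
  let ?c = "(1 - b / r) * exp (- b * t)"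
  let ?g = "\<lambda>x. ?c * (exp (- r * x) + b * (min x t * exp (- r * x)))"
  have c: "0 \<le> ?c"
    using b by simp
  have "ennreal (?c * (L r + b * ?J)) = (\<integral>\<^sup>+x. ennreal (?g x) \<partial>\<mu>)"
  proof (subst nn_integral_eq_integral)
    show "integrable \<mu> ?g"
      using r_pos t
      by (intro integrable_mult_right Bochner_Integration.integrable_add integrable_exp integrable_min_exp) auto
    show "AE x in \<mu>. 0 \<le> ?g x"
      using positive by eventually_elim (use c b t in \<open>auto intro!: mult_nonneg_nonneg add_nonneg_nonneg\<close>)
    show "ennreal (?c * (L r + b * ?J)) = ennreal (\<integral>x. ?g x \<partial>\<mu>)"
      using integrable_exp[of r] integrable_min_exp[OF t] r_pos
      by (simp add: laplace_transform_def)
  qed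
  also have "\<dots> \<le> (\<integral>\<^sup>+x. ennreal (exp (- r * x)) * ennreal ((1 - b / r) * exp (- b * max (t - x) 0)) \<partial>\<mu>)"
  proof (intro nn_integral_mono)
    fix x
    \<comment> \<open>Since \<open>t - max (t - x) 0 = min x t\<close>, the exponential factorises,
      and its second factor is linearised from below.\<close>
    have "1 + b * min x t \<le> exp (b * min x t)"
      by (rule exp_ge_add_one_self)
    then have "?c * (1 + b * min x t) \<le> ?c * exp (b * min x t)"
      by (rule mult_left_mono) fact
    also have "\<dots> = (1 - b / r) * exp (- b * max (t - x) 0)"
      by (cases "x \<le> t") (simp_all add: mult.assoc exp_add[symmetric] algebra_simps)
    finally have "?c * (1 + b * min x t) * exp (- r * x) \<le> (1 - b / r) * exp (- b * max (t - x) 0) * exp (- r * x)"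
      by (rule mult_right_mono) simp
    moreover have "c * (e + b * (m * e)) = c * (1 + b * m) * e" for c e m :: real
      by (simp add: algebra_simps)
    moreover have "0 \<le> 1 - b / r"
      using b by simp
    ultimately show "ennreal (?g x) \<le> ennreal (exp (- r * x)) * ennreal ((1 - b / r) * exp (- b * max (t - x) 0))"
      by (subst ennreal_mult[symmetric], simp, simp, subst mult.commute[of "exp (- r * x)"], intro ennreal_leI) (simp only:)
  qed
  also have "\<dots> \<le> ennreal (L r * prob {\<omega>\<in>space M. t < T \<omega>})"
    unfolding L_times_prob_gt by (intro nn_integral_mono mult_left_mono renewal_tail_ge b) auto
  finally have "?c * (L r + b * ?J) \<le> L r * prob {\<omega>\<in>space M. t < T \<omega>}"
    using L_pos[of r] r_pos by (subst (asm) ennreal_le_iff) auto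
  also have "L r + b * ?J = L r * (1 + b / L r * ?J)"
    using L_pos[of r] r_pos by (simp add: distrib_left)
  finally have "L r * (?c * (1 + b / L r * ?J)) \<le> L r * prob {\<omega>\<in>space M. t < T \<omega>}"
    by (simp only: mult.left_commute)
  then show ?thesis
    using L_pos[of r] r_pos by (simp only: mult_le_cancel_left_pos)
qed

end

section \<open>Kolmogorov distance\<close>

lemma cdf_exp_dist_1: "cdf (exp_dist 1) x = (if 0 \<le> x then 1 - exp (- x) else 0)"
  using emeasure_erlang_density[of 1 0 x]
  by (simp add: cdf_def exp_dist_def measure_def erlang_CDF_0)

lemma kolmogorov_dist_le:
  assumes "\<And>x. \<bar>cdf \<mu> x - cdf \<nu> x\<bar> \<le> B"
  shows "kolmogorov_dist \<mu> \<nu> \<le> B"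
  unfolding kolmogorov_dist_def using assms by (intro cSUP_least) auto

lemma kolmogorov_dist_ge:
  assumes "prob_space \<mu>" "prob_space \<nu>"
  shows "\<bar>cdf \<mu> x - cdf \<nu> x\<bar> \<le> kolmogorov_dist \<mu> \<nu>"
proof -
  interpret m: prob_space \<mu> by fact
  interpret n: prob_space \<nu> by fact
  have "\<bar>cdf \<mu> y - cdf \<nu> y\<bar> \<le> 1" for y
    using m.prob_le_1[of "{..y}"] n.prob_le_1[of "{..y}"]
      measure_nonneg[of \<mu> "{..y}"] measure_nonneg[of \<nu> "{..y}"]
    unfolding cdf_def by linarith
  then show ?thesis
    unfolding kolmogorov_dist_def by (intro cSUP_upper) (auto intro!: bdd_aboveI2)
qed

section \<open>Comparison of the normalized law with the exponential law\<close>

context positive_resetting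
begin

abbreviation (input) "normalized_law \<equiv> distr M borel (\<lambda>\<omega>. T \<omega> / expectation T)"

lemma cdf_normalized_law:
  assumes "0 < expectation T"
  shows "cdf normalized_law x = 1 - prob {\<omega>\<in>space M. x * expectation T < T \<omega>}"
proof -
  have "cdf normalized_law x = prob {\<omega>\<in>space M. T \<omega> / expectation T \<le> x}"
    unfolding cdf_def by (subst measure_distr) (auto intro!: arg_cong[where f = prob])
  also have "\<dots> = prob (space M - {\<omega>\<in>space M. x * expectation T < T \<omega>})"
    using assms by (intro arg_cong[where f = prob]) (auto simp: field_simps)
  also have "\<dots> = 1 - prob {\<omega>\<in>space M. x * expectation T < T \<omega>}"
    by (rule prob_compl) measurable
  finally show ?thesis .
qed

lemma prob_gt_neg:
  assumes "t < 0"
  shows "prob {\<omega>\<in>space M. t < T \<omega>} = 1"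
proof -
  have "AE \<omega> in M. \<omega> \<in> {\<omega>\<in>space M. t < T \<omega>}"
    using AE_completion_time_nonneg AE_space by eventually_elim (use assms in auto)
  then show ?thesis by (subst prob_eq_1) measurable
qed

lemma cdf_diff:
  assumes "0 < expectation T"
  shows "cdf normalized_law x - cdf (exp_dist 1) x =
    (if 0 \<le> x then exp (- x) - prob {\<omega>\<in>space M. x * expectation T < T \<omega>} else 0)"
  using assms by (simp add: cdf_normalized_law cdf_exp_dist_1 prob_gt_neg mult_neg_pos)

text \<open>Where \<open>x > t\<close>, the bound y^2 exp(-y) \<le> 2 at y = r x makes the integrand
  at most \<open>2 / (r * x)\<close>, hence at most \<open>2 / (r * t)\<close>.\<close>

lemma tilted_mean_tail:
  assumes t: "0 < t"
  shows "r * tilted_mean - 2 / (r * t) \<le> r * (\<integral>x. min x t * exp (- r * x) \<partial>\<mu>)"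
proof -
  have "(\<integral>x. r * (x * exp (- r * x)) - 2 / (r * t) \<partial>\<mu>) \<le> (\<integral>x. r * (min x t * exp (- r * x)) \<partial>\<mu>)"
  proof (rule integral_mono_AE)
    show "integrable \<mu> (\<lambda>x. r * (x * exp (- r * x)) - 2 / (r * t))"
      using integrable_tilted_mean by simp
    show "integrable \<mu> (\<lambda>x. r * (min x t * exp (- r * x)))"
      using integrable_min_exp[of t] t by simp
    show "AE x in \<mu>. r * (x * exp (- r * x)) - 2 / (r * t) \<le> r * (min x t * exp (- r * x))"
      using positive
    proof eventually_elim
      case (elim x)
      show ?case
      proof (cases "x \<le> t")
        case True
        then show ?thesis using r_pos t by simp
      next
        case False
        have rt: "0 < r * t" "r * t \<le> r * x" using r_pos t False by auto
        have "(r * x) * exp (- (r * x)) * (r * t) \<le> (r * x) * exp (- (r * x)) * (r * x)"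
          using rt False r_pos t by (intro mult_left_mono) auto
        also have "\<dots> \<le> 2"
          using mult_exp_minus_le(2)[of "r * x"] rt by (simp add: power2_eq_square mult_ac)
        finally have "r * (x * exp (- r * x)) \<le> 2 / (r * t)"
          using rt by (simp add: field_simps)
        moreover have "0 \<le> r * (min x t * exp (- r * x))"
          using r_pos t elim by simp
        ultimately show ?thesis by linarith
      qed
    qed
  qed
  then show ?thesis
    using integrable_tilted_mean base.prob_space by (simp add: tilted_mean_def)
qed

text \<open>The rate \<open>a = r * p\<close> is admissible because
  \<open>L (r - a) \<ge> L r = a / r\<close>. The prefactor exceeds 1 by at most
  \<open>D + 8 * p\<close>, and \<open>a * expectation T = 1 - p\<close> costs another
  \<open>p\<close>.\<close>

lemma prob_gt_upper:
  assumes p: "L r \<le> 1 / 2" and x: "0 \<le> x"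
  shows "prob {\<omega>\<in>space M. x * expectation T < T \<omega>} - exp (- x) \<le> r * tilted_mean + 9 * L r"
proof -
  define p D where "p = L r" and "D = r * tilted_mean"
  have p01: "0 < p" "p \<le> 1 / 2"
    using p L_pos[of r] r_pos by (auto simp: p_def)
  have D0: "0 \<le> D"
    using tilted_mean_nonneg r_pos by (simp add: D_def)
  define a where "a = r * p"
  have a: "0 \<le> a" "a < r" "\<bar>- a\<bar> \<le> r / 2" "a / r = p"
    using p01 r_pos by (auto simp: a_def)
  have "\<bar>L (r + (- a)) - L r + (- a) * tilted_mean\<bar> \<le> 8 * (- a / r)\<^sup>2"
    by (rule L_Taylor_bound[OF a(3)])
  moreover have "a * tilted_mean = p * D"
    by (simp add: a_def D_def)
  ultimately have "L (r - a) \<le> p + p * D + 8 * p\<^sup>2"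
    using a by (simp add: p_def abs_le_iff)
  then have "L (r - a) / L r \<le> 1 + D + 8 * p"
    using p01 by (simp add: p_def[symmetric] field_simps power2_eq_square)
  moreover have "a / r \<le> L (r - a)"
    using a L_antimono[of "r - a" r] by (simp add: p_def)
  then have "prob {\<omega>\<in>space M. x * expectation T < T \<omega>} \<le> exp (- a * (x * expectation T)) * (L (r - a) / L r)"
    by (intro prob_gt_le a)
  moreover have "a * (x * expectation T) = x * (1 - p)"
    using r_pos p01 by (simp add: a_def expectation_completion_time p_def[symmetric])
  ultimately have 1: "prob {\<omega>\<in>space M. x * expectation T < T \<omega>} \<le> exp (- (x * (1 - p))) * (1 + D + 8 * p)"
    by (smt (verit) exp_ge_zero mult_left_mono mult_minus_left)
  have "exp (- (x * (1 - p))) \<le> 1"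
    using x p01 by simp
  then have 2: "exp (- (x * (1 - p))) * (D + 8 * p) \<le> D + 8 * p"
    using D0 p01 by (intro mult_left_le_one_le) auto
  \<comment> \<open>The difference is at most x p exp(-y) with y = x (1 - p); this is bounded
    uniformly in \<open>x\<close> because y exp(-y) \<le> 1/2 and p \<le> 1/2.\<close>
  have "exp (- (x * (1 - p))) - exp (- x) \<le> p"
  proof -
    let ?y = "x * (1 - p)"
    have "exp (- x) = exp (- ?y) * exp (- (x * p))"
      by (simp add: exp_add[symmetric] algebra_simps)
    moreover have "1 + - (x * p) \<le> exp (- (x * p))"
      by (rule exp_ge_add_one_self)
    then have "exp (- ?y) * (1 + - (x * p)) \<le> exp (- ?y) * exp (- (x * p))"
      by (rule mult_left_mono) simp
    ultimately have "exp (- ?y) - exp (- x) \<le> x * p * exp (- ?y)"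
      by (simp add: algebra_simps)
    also have "\<dots> = p * ((?y * exp (- ?y)) / (1 - p))"
      using p01 by simp
    also have "\<dots> \<le> p * 1"
    proof (rule mult_left_mono)
      have "?y * exp (- ?y) \<le> 1 / 2"
        using x p01 by (intro mult_exp_minus_le) auto
      then show "(?y * exp (- ?y)) / (1 - p) \<le> 1"
        using p01 by (simp add: field_simps)
    qed (use p01 in simp)
    finally show ?thesis by simp
  qed
  with 1 2 show ?thesis
    by (simp add: p_def[symmetric] D_def[symmetric] algebra_simps)
qed

lemma prob_gt_lower:
  assumes p: "100 * L r \<le> r * tilted_mean" and x: "0 \<le> x"
  shows "(1 - 5 / 2 * L r) * exp (- (x * (1 + 3 * (r * tilted_mean)))) *
      (1 + r * (\<integral>y. min y (x * expectation T) * exp (- r * y) \<partial>\<mu>))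
    \<le> prob {\<omega>\<in>space M. x * expectation T < T \<omega>}"
proof -
  define p D where "p = L r" and "D = r * tilted_mean"
  have D: "100 * p \<le> D" "D \<le> 1 / 2" "0 < p"
    using p tilted_mean_le L_pos[of r] r_pos by (auto simp: p_def D_def)
  \<comment> \<open>The root of \<open>L (r - b) = b / r\<close> is p (1 + D) to leading order; the
    coefficient 3 leaves room for the quadratic error.\<close>
  define B b where "B = p * (1 + 3 * D)" and "b = r * B"
  let ?J = "\<integral>y. min y (x * expectation T) * exp (- r * y) \<partial>\<mu>"
  have B: "0 < B" "B \<le> 5 / 2 * p" "p \<le> B" "B \<le> 1 / 2"
  proof -
    have "p * (1 + 3 * D) \<le> p * (5 / 2)"
      using D by (intro mult_left_mono) auto
    then show "B \<le> 5 / 2 * p" by (simp add: B_def)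
    then show "B \<le> 1 / 2" using D by linarith
    show "0 < B" "p \<le> B" using D by (auto simp: B_def)
  qed
  have b: "0 \<le> b" "b < r" "\<bar>- b\<bar> \<le> r / 2" "b / r = B"
    using B r_pos by (auto simp: b_def)
  have lb: "L (r - b) \<le> b / r"
  proof -
    have "\<bar>L (r + (- b)) - L r + (- b) * tilted_mean\<bar> \<le> 8 * (- b / r)\<^sup>2"
      by (rule L_Taylor_bound[OF b(3)])
    moreover have "b * tilted_mean = B * D"
      by (simp add: b_def D_def)
    ultimately have "L (r - b) \<le> p + B * D + 8 * B\<^sup>2"
      using b by (simp add: p_def abs_le_iff)
    also have "\<dots> \<le> B"
    proof -
      have "B\<^sup>2 \<le> (5 / 2 * p)\<^sup>2"
        using B by (intro power_mono) auto
      \<comment> \<open>It remains to fit 8 B^2 \<le> 50 p^2 into B - p - B D = p D (2 - 3 D). This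
        uses \<open>D \<le> 1 / 2\<close> and \<open>100 * p \<le> D\<close>.\<close>
      then have "8 * B\<^sup>2 \<le> p * (50 * p)"
        by (simp add: power2_eq_square)
      also have "\<dots> \<le> p * (D * (2 - 3 * D))"
      proof (rule mult_left_mono)
        have "D * (1 / 2) \<le> D * (2 - 3 * D)"
          using D by (intro mult_left_mono) auto
        then show "50 * p \<le> D * (2 - 3 * D)"
          using D by linarith
      qed (use D in simp)
      finally show ?thesis
        by (simp add: B_def algebra_simps)
    qed
    finally show ?thesis using b by simp
  qed
  have m: "0 \<le> expectation T"
    using AE_completion_time_nonneg by (rule integral_nonneg_AE)
  have J: "0 \<le> ?J"
    using positive x m by (intro integral_nonneg_AE) (auto elim!: eventually_mono)
  have "(1 - 5 / 2 * p) * exp (- (x * (1 + 3 * D))) * (1 + r * ?J)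
      \<le> (1 - B) * exp (- (b * (x * expectation T))) * (1 + b / L r * ?J)"
  proof (intro mult_mono)
    have "b * (x * expectation T) = x * ((1 + 3 * D) * (1 - p))"
      using r_pos D by (simp add: b_def B_def expectation_completion_time p_def[symmetric])
    also have "\<dots> \<le> x * ((1 + 3 * D) * 1)"
      using x D by (intro mult_left_mono) auto
    finally show "exp (- (x * (1 + 3 * D))) \<le> exp (- (b * (x * expectation T)))"
      by simp
    have "r * 1 \<le> r * (1 + 3 * D)"
      using r_pos D by (intro mult_left_mono) auto
    then have "r \<le> b / L r"
      using D by (simp add: b_def B_def p_def[symmetric])
    then show "1 + r * ?J \<le> 1 + b / L r * ?J"
      using J by (intro add_left_mono mult_right_mono) auto
  qed (use B D J r_pos in auto)
  also have "\<dots> \<le> prob {\<omega>\<in>space M. x * expectation T < T \<omega>}"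
    using prob_gt_ge[OF b(1,2) lb, of "x * expectation T"] x m b by simp
  finally show ?thesis
    by (simp add: p_def D_def)
qed


lemma expectation_completion_time_pos: "L r < 1 \<Longrightarrow> 0 < expectation T"
  using L_pos[of r] r_pos by (simp add: expectation_completion_time)

text \<open>The tail exceeds the exponential one by at most \<open>D + 9 * p\<close> and falls short
  of it by at most \<open>3 / 2 * D + 5 / 2 * p\<close>, where 3/2 is 3 times the bound 1/2 for x
  exp(-x). The terms in \<open>p\<close> fit into the slack up to 8/5.\<close>

lemma kolmogorov_dist_upper:
  assumes p: "392 * L r \<le> r * tilted_mean"
  shows "kolmogorov_dist normalized_law (exp_dist 1) \<le> 8 / 5 * (r * tilted_mean)"
proof (rule kolmogorov_dist_le)
  fix x
  define p D where "p = L r" and "D = r * tilted_mean"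
  have D: "392 * p \<le> D" "D \<le> 1 / 2" "0 < p"
    using p tilted_mean_le L_pos[of r] r_pos by (auto simp: p_def D_def)
  have m: "0 < expectation T"
    using D by (intro expectation_completion_time_pos) (simp add: p_def)
  show "\<bar>cdf normalized_law x - cdf (exp_dist 1) x\<bar> \<le> 8 / 5 * (r * tilted_mean)"
  proof (cases "0 \<le> x")
    case x: True
    let ?P = "prob {\<omega>\<in>space M. x * expectation T < T \<omega>}"
    let ?J = "\<integral>y. min y (x * expectation T) * exp (- r * y) \<partial>\<mu>"
    have "?P - exp (- x) \<le> D + 9 * p"
      unfolding p_def D_def using D x by (intro prob_gt_upper) (auto simp: p_def)
    moreover have "exp (- x) - ?P \<le> 5 / 2 * p + 3 / 2 * D"
    proof -
      let ?e = "exp (- (x * (1 + 3 * D)))"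
      have J: "0 \<le> ?J"
        using positive x m by (intro integral_nonneg_AE) (auto elim!: eventually_mono)
      \<comment> \<open>For this direction the delay due to the successful attempt is simply
        discarded.\<close>
      have "(1 - 5 / 2 * p) * ?e * 1 \<le> (1 - 5 / 2 * p) * ?e * (1 + r * ?J)"
        using D J r_pos by (intro mult_left_mono) auto
      also have "\<dots> \<le> ?P"
        unfolding p_def D_def using D x by (intro prob_gt_lower) (auto simp: p_def D_def)
      finally have 1: "?e - 5 / 2 * p * ?e \<le> ?P"
        by (simp add: algebra_simps)
      have "5 / 2 * p * ?e \<le> 5 / 2 * p"
        using D x by (intro mult_left_le) auto
      moreover have "exp (- x) - ?e \<le> 3 / 2 * D"
      proof -
        have "exp (- x) * (1 + - (3 * D * x)) \<le> exp (- x) * exp (- (3 * D * x))"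
          by (intro mult_left_mono exp_ge_add_one_self) simp
        also have "\<dots> = ?e"
          by (simp add: exp_add[symmetric] algebra_simps)
        finally have "exp (- x) - ?e \<le> 3 * D * (x * exp (- x))"
          by (simp add: algebra_simps)
        also have "\<dots> \<le> 3 * D * (1 / 2)"
          using D x by (intro mult_left_mono mult_exp_minus_le) auto
        finally show ?thesis by simp
      qed
      ultimately show ?thesis
        using 1 by linarith
    qed
    ultimately have "\<bar>exp (- x) - ?P\<bar> \<le> 8 / 5 * D"
      using D by linarith
    then show ?thesis
      unfolding cdf_diff[OF m] by (simp add: x D_def)
  next
    case False
    then show ?thesis
      using D unfolding cdf_diff[OF m] by (simp add: D_def[symmetric])
  qed
qed

text \<open>Evaluate at \<open>x = e\<close>. As \<open>e\<close> is small, the rate error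
  \<open>3 * D * e\<close> is small compared with \<open>D\<close>; as
  \<open>r * (e * expectation T) = e * (1 - p) / p\<close> is large, truncation hardly reduces the
  tilted mean.\<close>

lemma kolmogorov_dist_lower:
  assumes e: "0 < e" "e \<le> 1 / 7" and p: "8 * L r \<le> e\<^sup>2 * (r * tilted_mean)"
  shows "(1 - 7 * e) * (r * tilted_mean) \<le> kolmogorov_dist normalized_law (exp_dist 1)"
proof -
  define p D where "p = L r" and "D = r * tilted_mean"
  have D01: "0 \<le> D" "D \<le> 1 / 2" "0 < p" "8 * p \<le> e\<^sup>2 * D"
    using p tilted_mean_le tilted_mean_nonneg L_pos[of r] r_pos by (auto simp: p_def D_def)
  have "e\<^sup>2 * D \<le> (1 / 7)\<^sup>2 * D"
    using e D01 by (intro mult_right_mono power_mono) auto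
  then have D: "392 * p \<le> D"
    using D01 by (simp add: power2_eq_square)
  have eD: "4 * p / e \<le> e * D / 2" "4 * p \<le> e * D / 2"
  proof -
    show "4 * p / e \<le> e * D / 2"
      using D01 e by (simp add: field_simps power2_eq_square)
    have "e\<^sup>2 * D \<le> e * D"
      using e D01 by (intro mult_right_mono) (auto simp: power2_eq_square)
    then show "4 * p \<le> e * D / 2"
      using D01 by simp
  qed
  have m: "0 < expectation T"
    using D D01 by (intro expectation_completion_time_pos) (simp add: p_def)
  let ?t = "e * expectation T"
  let ?P = "prob {\<omega>\<in>space M. ?t < T \<omega>}"
  let ?J = "\<integral>y. min y ?t * exp (- r * y) \<partial>\<mu>"
  \<comment> \<open>What is left of \<open>D\<close> after truncation at \<open>?t\<close>; the loss
    \<open>2 / (r * ?t)\<close> is at most \<open>4 * p / e\<close> since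
    \<open>p \<le> 1 / 2\<close>.\<close>
  define D' where "D' = D - 4 * p / e"
  have D': "D' \<le> r * ?J" "0 \<le> D'" "D' \<le> 1 / 2"
  proof -
    have "r * ?t = e * (1 - p) / p"
      using r_pos by (simp add: expectation_completion_time p_def)
    then have "2 / (r * ?t) = 2 * p / (e * (1 - p))"
      by simp
    also have "\<dots> \<le> 4 * p / e"
      using e D01 D by (simp add: field_simps)
    finally have "2 / (r * ?t) \<le> 4 * p / e" .
    then show "D' \<le> r * ?J"
      using tilted_mean_tail[of ?t] m e by (simp add: D'_def D_def)
    have "e * D / 2 \<le> D"
      using e D01 mult_right_mono[of e 2 D] by simp
    then show "0 \<le> D'"
      using eD by (simp add: D'_def)
    show "D' \<le> 1 / 2"
      using D01 e by (simp add: D'_def) (smt (verit) divide_nonneg_pos)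
  qed
  \<comment> \<open>Total first-order loss: the prefactor of \<open>prob_gt_lower\<close> and the
    excess rate \<open>3 * D\<close> over time \<open>e\<close>.\<close>
  define \<beta> where "\<beta> = 5 / 2 * p + 3 * D * e"
  have \<beta>: "0 \<le> \<beta>"
    using D01 e by (simp add: \<beta>_def)
  have P: "exp (- e) * ((1 - \<beta>) * (1 + D')) \<le> ?P"
  proof -
    have "exp (- e) * (1 - 3 * D * e) \<le> exp (- e) * exp (- (3 * D * e))"
      using exp_ge_add_one_self[of "- (3 * D * e)"] by (intro mult_left_mono) auto
    also have "\<dots> = exp (- (e * (1 + 3 * D)))"
      by (simp add: exp_add[symmetric] algebra_simps)
    finally have 1: "exp (- e) * (1 - 3 * D * e) \<le> exp (- (e * (1 + 3 * D)))" .
    have "1 - \<beta> \<le> (1 - 5 / 2 * p) * (1 - 3 * D * e)"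
      using D01 e by (simp add: \<beta>_def algebra_simps)
    then have "exp (- e) * (1 - \<beta>) \<le> exp (- e) * ((1 - 5 / 2 * p) * (1 - 3 * D * e))"
      by (rule mult_left_mono) simp
    also have "\<dots> = (1 - 5 / 2 * p) * (exp (- e) * (1 - 3 * D * e))"
      by simp
    also have "\<dots> \<le> (1 - 5 / 2 * p) * exp (- (e * (1 + 3 * D)))"
      using D D01 by (intro mult_left_mono 1) auto
    finally have "exp (- e) * (1 - \<beta>) * (1 + D') \<le> (1 - 5 / 2 * p) * exp (- (e * (1 + 3 * D))) * (1 + D')"
      using D' by (intro mult_right_mono) auto
    also have "\<dots> \<le> (1 - 5 / 2 * p) * exp (- (e * (1 + 3 * D))) * (1 + r * ?J)"
      using D' D D01 by (intro mult_left_mono) auto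
    also have "\<dots> \<le> ?P"
      unfolding p_def D_def using D e D01 by (intro prob_gt_lower) (auto simp: p_def D_def)
    finally show ?thesis by (simp add: mult.assoc)
  qed
  have "\<beta> * (1 + D') \<le> \<beta> * (3 / 2)"
    using \<beta> D' by (intro mult_left_mono) auto
  \<comment> \<open>The losses are e D / 2 from truncation, e D / 2 from the prefactor and 9/2 e D
    from the excess rate.\<close>
  then have "D * (1 - 11 / 2 * e) \<le> (1 - \<beta>) * (1 + D') - 1"
    using eD D01 by (simp add: \<beta>_def D'_def algebra_simps)
  then have "exp (- e) * (D * (1 - 11 / 2 * e)) \<le> exp (- e) * ((1 - \<beta>) * (1 + D') - 1)"
    by (rule mult_left_mono) simp
  also have "\<dots> \<le> ?P - exp (- e)"
    using P by (simp add: algebra_simps)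
  finally have 2: "exp (- e) * (D * (1 - 11 / 2 * e)) \<le> ?P - exp (- e)" .
  \<comment> \<open>Expanding the product gives 1 - 13/2 e + 11/2 e^2, which is at least 1 - 7
    e.\<close>
  have "(1 - 7 * e) * D \<le> ((1 - e) * (1 - 11 / 2 * e)) * D"
    using e D01 by (intro mult_right_mono) (auto simp: algebra_simps)
  also have "\<dots> \<le> exp (- e) * (D * (1 - 11 / 2 * e))"
    using e D01 exp_ge_add_one_self[of "- e"]
      mult_right_mono[of "1 - e" "exp (- e)" "(1 - 11 / 2 * e) * D"] by (simp add: mult_ac)
  also note 2
  also have "?P - exp (- e) \<le> \<bar>cdf normalized_law e - cdf (exp_dist 1) e\<bar>"
    using e by (simp add: cdf_diff[OF m])
  also have "\<dots> \<le> kolmogorov_dist normalized_law (exp_dist 1)"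
    by (intro kolmogorov_dist_ge prob_space_distr prob_space_exp_dist) auto
  finally show ?thesis by (simp add: D_def)
qed

end

section \<open>From D to alpha and the limit along the family\<close>

lemma (in base_time) laplace_transform_distr:
  "laplace_transform (distr N borel T0) (\<lambda>x. x) = laplace_transform N T0"
  unfolding laplace_transform_def using measurable_T0 by (simp add: integral_distr)

text \<open>Non-asymptotic form of the theorem. By \<open>deriv_L\<close>, alpha is (p - D) / (1 -
  p); since \<open>p\<close> is negligible against \<open>\<bar>\<alpha>\<bar>\<close>, this places
  \<open>D\<close> between \<open>(1 - \<epsilon>) * \<bar>\<alpha>\<bar>\<close> and
  \<open>\<bar>\<alpha>\<bar> + p\<close>.\<close>

lemma resetting_estimate:
  fixes \<alpha> p \<epsilon> :: real
  assumes r: "r > 0" and base: "base_time N T0"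
    and resetting: "poisson_resetting M X \<tau> r (distr N borel T0)"
    and p: "p = laplace_transform N T0 r"
    and \<alpha>: "\<alpha> = (p + r * deriv (laplace_transform N T0) r) / (1 - p)"
    and e: "0 < \<epsilon>" "\<epsilon> \<le> 1 / 8" and small: "p \<le> \<epsilon>" and large: "20 / \<epsilon>\<^sup>2 \<le> \<bar>\<alpha>\<bar> / p"
  shows "kolmogorov_dist (distr M borel (\<lambda>\<omega>. completion_time X \<tau> \<omega> /
      prob_space.expectation M (completion_time X \<tau>))) (exp_dist 1) \<in> {(1 - 8 * \<epsilon>) * \<bar>\<alpha>\<bar> .. 2 * \<bar>\<alpha>\<bar>}"
proof -
  interpret N: base_time N T0 by fact
  interpret P: poisson_resetting M X \<tau> r "distr N borel T0" by fact
  interpret positive_resetting M X \<tau> r "distr N borel T0"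
  proof
    show "AE x in distr N borel T0. 0 < x"
      using N.positive_T0 N.measurable_T0 by (subst AE_distr_iff) auto
  qed (rule r)
  define D where "D = r * tilted_mean"
  have pL: "p = L r"
    by (simp add: p N.laplace_transform_distr)
  have "\<alpha> = (p + r * deriv L r) / (1 - p)"
    by (simp add: \<alpha> N.laplace_transform_distr)
  then have \<alpha>': "\<alpha> = (p - D) / (1 - p)"
    by (simp add: deriv_L D_def)
  have p01: "0 < p" "p \<le> 1 / 8"
    using L_pos[of r] r small e by (auto simp: pL)
  have D0: "0 \<le> D"
    using tilted_mean_nonneg r by (simp add: D_def)
  have K: "20 * p \<le> \<epsilon>\<^sup>2 * \<bar>\<alpha>\<bar>"
    using large p01 e by (simp add: field_simps)
  have "\<epsilon>\<^sup>2 * \<bar>\<alpha>\<bar> \<le> 1 * \<bar>\<alpha>\<bar>"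
    using e by (intro mult_right_mono) (auto simp: power_le_one)
  then have K1: "20 * p \<le> \<bar>\<alpha>\<bar>"
    using K by simp
  \<comment> \<open>This fixes the sign of alpha: otherwise \<open>\<bar>\<alpha>\<bar>\<close>
    would be at most \<open>2 * p\<close>, against
    \<open>20 * p \<le> \<bar>\<alpha>\<bar>\<close>.\<close>
  have "p < D"
  proof (rule ccontr)
    assume "\<not> p < D"
    then have "\<bar>\<alpha>\<bar> \<le> p / (1 - p)"
      using p01 D0 by (simp add: \<alpha>' divide_right_mono)
    also have "\<dots> \<le> p * 2"
      using p01 by (simp add: field_simps)
    finally show False using K1 p01 by simp
  qed
  then have "\<bar>\<alpha>\<bar> = (D - p) / (1 - p)"
    using p01 by (simp add: \<alpha>')
  then have Deq: "D = \<bar>\<alpha>\<bar> * (1 - p) + p"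
    using p01 by (simp add: field_simps)
  have "(1 - \<epsilon>) * \<bar>\<alpha>\<bar> \<le> (1 - p) * \<bar>\<alpha>\<bar>"
    using small by (intro mult_right_mono) auto
  then have D1: "(1 - \<epsilon>) * \<bar>\<alpha>\<bar> \<le> D"
    using p01 by (simp add: Deq mult.commute)
  have D2: "D \<le> \<bar>\<alpha>\<bar> + p"
    using p01 by (simp add: Deq algebra_simps)
  have D3: "\<bar>\<alpha>\<bar> / 2 \<le> D"
    using D1 e mult_right_mono[of "1 / 2" "1 - \<epsilon>" "\<bar>\<alpha>\<bar>"] by simp
  have "\<epsilon>\<^sup>2 * (\<bar>\<alpha>\<bar> / 2) \<le> \<epsilon>\<^sup>2 * D"
    by (intro mult_left_mono D3) simp
  then have pD: "8 * p \<le> \<epsilon>\<^sup>2 * D"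
    using K p01 by simp
  have "\<epsilon>\<^sup>2 * D \<le> (1 / 8)\<^sup>2 * D"
    using e D0 by (intro mult_right_mono power_mono) auto
  then have pD': "392 * p \<le> D"
    using pD p01 by (simp add: power2_eq_square)
  have "(1 - 8 * \<epsilon>) * \<bar>\<alpha>\<bar> \<le> (1 - 7 * \<epsilon>) * ((1 - \<epsilon>) * \<bar>\<alpha>\<bar>)"
    using mult_right_mono[of "1 - 8 * \<epsilon>" "(1 - 7 * \<epsilon>) * (1 - \<epsilon>)" "\<bar>\<alpha>\<bar>"]
    by (simp add: algebra_simps)
  also have "\<dots> \<le> (1 - 7 * \<epsilon>) * D"
    using e by (intro mult_left_mono D1) auto
  also have "\<dots> \<le> kolmogorov_dist normalized_law (exp_dist 1)"
    unfolding D_def using e pD by (intro kolmogorov_dist_lower) (auto simp: pL D_def)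
  finally have "(1 - 8 * \<epsilon>) * \<bar>\<alpha>\<bar> \<le> kolmogorov_dist normalized_law (exp_dist 1)" .
  moreover have "kolmogorov_dist normalized_law (exp_dist 1) \<le> 8 / 5 * D"
    unfolding D_def using pD' by (intro kolmogorov_dist_upper) (simp add: pL D_def)
  \<comment> \<open>Here \<open>p \<le> \<bar>\<alpha>\<bar> / 20\<close>, and 8/5 times 21/20 is
    less than 2.\<close>
  then have "kolmogorov_dist normalized_law (exp_dist 1) \<le> 2 * \<bar>\<alpha>\<bar>"
    using D2 K1 by simp
  ultimately show ?thesis by simp
qed

theorem theorem5p12:
  fixes r :: real
    and F :: "'i filter"
    and N :: "'i \<Rightarrow> 'b measure" and T0 :: "'i \<Rightarrow> 'b \<Rightarrow> real"
    and M :: "'i \<Rightarrow> 'a measure" and X \<tau> :: "'i \<Rightarrow> nat \<Rightarrow> 'a \<Rightarrow> real"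
    and T :: "'i \<Rightarrow> 'a \<Rightarrow> real" and p \<alpha> :: "'i \<Rightarrow> real"
  assumes r: "r > 0"
    and base: "\<And>i. base_time (N i) (T0 i)"
    and resetting: "\<And>i. poisson_resetting (M i) (X i) (\<tau> i) r (distr (N i) borel (T0 i))"
    and T: "\<And>i. T i = completion_time (X i) (\<tau> i)"
    and p: "\<And>i. p i = laplace_transform (N i) (T0 i) r"
    and \<alpha>: "\<And>i. \<alpha> i = (p i + r * deriv (laplace_transform (N i) (T0 i)) r) / (1 - p i)"
    and p_lim: "(p \<longlongrightarrow> 0) F"
    and \<alpha>_lim: "filterlim (\<lambda>i. \<bar>\<alpha> i\<bar> / p i) at_top F"
  shows "\<forall>\<eta>>0. \<forall>\<^sub>F i in F.
    kolmogorov_dist (distr (M i) borel (\<lambda>\<omega>. T i \<omega> / prob_space.expectation (M i) (T i))) (exp_dist 1)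
      \<in> {(1 - \<eta>) * \<bar>\<alpha> i\<bar> .. (2 + \<eta>) * \<bar>\<alpha> i\<bar>}"
proof (intro allI impI)
  fix \<eta> :: real assume \<eta>: "0 < \<eta>"
  \<comment> \<open>The lower estimate loses \<open>8 * \<epsilon>\<close>, so this choice stays
    within \<open>\<eta>\<close> and also ensures \<open>\<epsilon> \<le> 1 / 8\<close>.\<close>
  define \<epsilon> where "\<epsilon> = min \<eta> 1 / 8"
  have e: "0 < \<epsilon>" "\<epsilon> \<le> 1 / 8" "8 * \<epsilon> \<le> \<eta>"
    using \<eta> by (auto simp: \<epsilon>_def)
  have "\<forall>\<^sub>F i in F. p i < \<epsilon>"
    using p_lim e(1) by (rule order_tendstoD)
  moreover have "\<forall>\<^sub>F i in F. 20 / \<epsilon>\<^sup>2 \<le> \<bar>\<alpha> i\<bar> / p i"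
    using \<alpha>_lim by (auto simp: filterlim_at_top)
  ultimately show "\<forall>\<^sub>F i in F.
    kolmogorov_dist (distr (M i) borel (\<lambda>\<omega>. T i \<omega> / prob_space.expectation (M i) (T i))) (exp_dist 1)
      \<in> {(1 - \<eta>) * \<bar>\<alpha> i\<bar> .. (2 + \<eta>) * \<bar>\<alpha> i\<bar>}"
  proof eventually_elim
    case (elim i)
    let ?d = "kolmogorov_dist (distr (M i) borel (\<lambda>\<omega>. T i \<omega> / prob_space.expectation (M i) (T i))) (exp_dist 1)"
    have "?d \<in> {(1 - 8 * \<epsilon>) * \<bar>\<alpha> i\<bar> .. 2 * \<bar>\<alpha> i\<bar>}"
      unfolding T using elim
      by (intro resetting_estimate[OF r base resetting p \<alpha> e(1,2)]) auto
    moreover have "(1 - \<eta>) * \<bar>\<alpha> i\<bar> \<le> (1 - 8 * \<epsilon>) * \<bar>\<alpha> i\<bar>" "2 * \<bar>\<alpha> i\<bar> \<le> (2 + \<eta>) * \<bar>\<alpha> i\<bar>"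
      using e \<eta> by (auto intro!: mult_right_mono)
    ultimately show ?case by (auto intro: order_trans)
  qed
qed

end
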